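(* Let $0<r_2<r_1<+\infty$ and $0<s_1<s_2<+\infty$ be such that $\lfloor s_1\rfloor=\lfloor s_2\rfloor=k$, where $\lfloor s\rfloor$ denotes the largest integer strictly smaller than $s$. Let $0<\delta\le1$, $p>1$, $\mu\in\mathcal R(x_0,\beta)$ with $\beta>-1$, $\omega_i(h)=r_ih^{s_i}$ and $\mathcal F_i=\mathcal F_\delta(x_0,\omega_i)$ for $i=1,2$. If an estimator $\hat f_n$ is asymptotically minimax over $\mathcal F_1$ and $\mathcal F_2$, that is, for $i=1,2$, $$\limsup_n\ \sup_{f\in\mathcal F_i}\psi_{n,i}^{-p}\,\mathbb{E}^n_{f,\mu}\{|\hat f_n(x_0)-f(x_0)|^p\}<+\infty,$$ then this estimator also satisfies $$\liminf_n\ \sup_{f\in\mathcal F_1}r_{n,1}^{-p}\,\mathbb{E}^n_{f,\mu}\{|\hat f_n(x_0)-f(x_0)|^p\}>0.$$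
   Context: **Model.** One observes $n$ i.i.d. pairs $(X_i,Y_i)$ with $Y_i=f(X_i)+\xi_i$, where $f$ is an unknown real function on $[0,1]$, the $\xi_i$ are centered Gaussian with variance $\sigma^2>0$, independent of $(X_1,\dots,X_n)$, and the $X_i\in[0,1]$ have density $\mu$. The point $x_0$ is fixed. $\mathbb{E}^n_{f,\mu}$ is the expectation with respect to the joint law of the observations. An estimator is a measurable function of these observations. **Regular variation and classes.** With $\mathbb{R}^+=(0,\infty)$, a continuous $\nu:\mathbb{R}^+\to\mathbb{R}^+$ is in $\mathrm{RV}(\beta)$, $\beta\in\mathbb{R}$ (regularly varying at $0$ of index $\beta$) if $\lim_{h\to0^+}\nu(yh)/\nu(h)=y^\beta$ for all $y>0$. For $\beta>-1$ and $W$ a neighbourhood of $x_0$, $\mathcal R(x_0,\beta)$ is the set of densities $\mu$ for which there is $\nu\in\mathrm{RV}(\beta)$ with $\mu(x)=\nu(|x-x_0|)$ for all $x\in W$; $\nu$ below is this function. For $\omega\in\mathrm{RV}(s)$, $s>0$, and $\delta>0$, $\mathcal F_\delta(x_0,\omega)$ is the set of $f:\mathbb{R}\to\mathbb{R}$ such that for all $h\le\delta$, $\inf_{P\in\mathcal P_k}\sup_{|x-x_0|\le h}|f(x)-P(x-x_0)|\le\omega(h)$, where $k$ is the largest integer strictly smaller than $s$ and $\mathcal P_k$ is the set of real polynomials of degree $k$ (at most $k$). **Rates.** For $i=1,2$, $\psi_{n,i}=\omega_i(\gamma_{n,i})$ where $\gamma_{n,i}$ is the smallest solution $h$ of $\omega_i(h)=\dfrac{\sigma}{\sqrt{2n\int_0^h\nu(t)\,dt}}$.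 $r_{n,1}=\omega_1(h_{n,1})$ where $h_{n,1}$ is the smallest solution $h$ of $\omega_1(h)=\sigma\sqrt{\dfrac{\log n}{2n\int_0^h\nu(t)\,dt}}$. These are defined for $n$ large. *)

theory Defs
  imports "HOL-Probability.Probability" "HOL-Computational_Algebra.Polynomial"
begin

(* The largest integer strictly smaller than s; it differs from floor at integers. *)
definition strict_floor :: "real \<Rightarrow> int" where
  "strict_floor s = (GREATEST m. real_of_int m < s)"

lemma strict_floor_eq_ceiling: "strict_floor s = \<lceil>s\<rceil> - 1"
  unfolding strict_floor_def
  by (rule Greatest_equality) linarith+

(* Only the values on {0<..} are relevant; functions on the positive half-line
   are represented by total functions. *)
definition RV :: "real \<Rightarrow> (real \<Rightarrow> real) set" where
  "RV \<beta> = {\<nu>. continuous_on {0<..} \<nu> \<and> (\<forall>h>0. \<nu> h > 0) \<and>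
     (\<forall>y>0. ((\<lambda>h. \<nu> (y * h) / \<nu> h) \<longlongrightarrow> y powr \<beta>) (at_right 0))}"

definition unit_density :: "(real \<Rightarrow> real) \<Rightarrow> bool" where
  "unit_density \<mu> \<longleftrightarrow> \<mu> \<in> borel_measurable borel \<and> (\<forall>x. 0 \<le> \<mu> x) \<and>
     (\<forall>x. x \<notin> {0..1} \<longrightarrow> \<mu> x = 0) \<and> (\<integral>\<^sup>+x. ennreal (\<mu> x) \<partial>lborel) = 1"

(* The neighbourhood is taken in the design space {0..1}. The point x0 is left out
   because \<nu> lives on the positive half-line. *)
definition local_profile :: "real \<Rightarrow> real set \<Rightarrow> real \<Rightarrow> (real \<Rightarrow> real) \<Rightarrow> (real \<Rightarrow> real) \<Rightarrow> bool" where
  "local_profile x0 W \<beta> \<mu> \<nu> \<longleftrightarrow> \<nu> \<in> RV \<beta> \<and> (\<forall>x\<in>W \<inter> {0..1} - {x0}. \<mu> x = \<nu> \<bar>x - x0\<bar>)"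

definition design_class :: "real \<Rightarrow> real set \<Rightarrow> real \<Rightarrow> (real \<Rightarrow> real) set" where
  "design_class x0 W \<beta> = {\<mu>. unit_density \<mu> \<and> (\<exists>\<nu>. local_profile x0 W \<beta> \<mu> \<nu>)}"

(* s is the index of regular variation of \<omega>. The infimum and supremum are taken in
   ennreal, so a locally unbounded f has infinite local error. *)
definition smoothness_class :: "real \<Rightarrow> real \<Rightarrow> real \<Rightarrow> (real \<Rightarrow> real) \<Rightarrow> (real \<Rightarrow> real) set" where
  "smoothness_class \<delta> x0 s \<omega> = {f. \<forall>h. 0 < h \<and> h \<le> \<delta> \<longrightarrow>
     (INF P\<in>{P. int (degree P) \<le> strict_floor s}.
        SUP x\<in>{x. \<bar>x - x0\<bar> \<le> h}. ennreal \<bar>f x - poly P (x - x0)\<bar>) \<le> ennreal (\<omega> h)}"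

(* Joint law of (X, Y) with Y = f X + \<xi>; \<sigma> is the standard deviation of the noise. *)
definition pair_law :: "real \<Rightarrow> (real \<Rightarrow> real) \<Rightarrow> (real \<Rightarrow> real) \<Rightarrow> (real \<times> real) measure" where
  "pair_law \<sigma> \<mu> f =
     distr (density lborel (\<lambda>x. ennreal (\<mu> x)) \<Otimes>\<^sub>M density lborel (\<lambda>z. ennreal (normal_density 0 \<sigma> z)))
       (borel \<Otimes>\<^sub>M borel) (\<lambda>(x, \<xi>). (x, f x + \<xi>))"

definition sample_law :: "real \<Rightarrow> nat \<Rightarrow> (real \<Rightarrow> real) \<Rightarrow> (real \<Rightarrow> real) \<Rightarrow> (nat \<Rightarrow> real \<times> real) measure" where
  "sample_law \<sigma> n \<mu> f = (\<Pi>\<^sub>M i\<in>{..<n}. pair_law \<sigma> \<mu> f)"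

(* An estimator T maps the sample size, the sample and the evaluation point to a real. *)
definition estimator_at :: "real \<Rightarrow> (nat \<Rightarrow> (nat \<Rightarrow> real \<times> real) \<Rightarrow> real \<Rightarrow> real) \<Rightarrow> bool" where
  "estimator_at x0 T \<longleftrightarrow>
     (\<forall>n. (\<lambda>D. T n D x0) \<in> borel_measurable (\<Pi>\<^sub>M i\<in>{..<n}. borel \<Otimes>\<^sub>M borel))"

definition pointwise_risk ::
  "real \<Rightarrow> real \<Rightarrow> real \<Rightarrow> (real \<Rightarrow> real) \<Rightarrow> (nat \<Rightarrow> (nat \<Rightarrow> real \<times> real) \<Rightarrow> real \<Rightarrow> real) \<Rightarrow>
   nat \<Rightarrow> (real \<Rightarrow> real) \<Rightarrow> ennreal" where
  "pointwise_risk x0 \<sigma> p \<mu> T n f =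
     (\<integral>\<^sup>+D. ennreal (\<bar>T n D x0 - f x0\<bar> powr p) \<partial>sample_law \<sigma> n \<mu> f)"

(* The law of the observations only makes sense for measurable f. *)
definition max_risk ::
  "real \<Rightarrow> real \<Rightarrow> real \<Rightarrow> (real \<Rightarrow> real) \<Rightarrow> (nat \<Rightarrow> (nat \<Rightarrow> real \<times> real) \<Rightarrow> real \<Rightarrow> real) \<Rightarrow>
   (real \<Rightarrow> real) set \<Rightarrow> (nat \<Rightarrow> real) \<Rightarrow> nat \<Rightarrow> ennreal" where
  "max_risk x0 \<sigma> p \<mu> T F r n =
     (SUP f\<in>F \<inter> borel_measurable borel. ennreal (r n powr (- p)) * pointwise_risk x0 \<sigma> p \<mu> T n f)"

(* The defining equations of the two bandwidths have a solution for all large n;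
   for the remaining n the values below carry no information. *)
definition minimax_bandwidth :: "real \<Rightarrow> (real \<Rightarrow> real) \<Rightarrow> (real \<Rightarrow> real) \<Rightarrow> nat \<Rightarrow> real" where
  "minimax_bandwidth \<sigma> \<nu> \<omega> n =
     (LEAST h. 0 < h \<and> \<omega> h = \<sigma> / sqrt (2 * real n * (LBINT t:{0<..h}. \<nu> t)))"

definition minimax_rate :: "real \<Rightarrow> (real \<Rightarrow> real) \<Rightarrow> (real \<Rightarrow> real) \<Rightarrow> nat \<Rightarrow> real" where
  "minimax_rate \<sigma> \<nu> \<omega> n = \<omega> (minimax_bandwidth \<sigma> \<nu> \<omega> n)"

definition adaptive_bandwidth :: "real \<Rightarrow> (real \<Rightarrow> real) \<Rightarrow> (real \<Rightarrow> real) \<Rightarrow> nat \<Rightarrow> real" where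
  "adaptive_bandwidth \<sigma> \<nu> \<omega> n =
     (LEAST h. 0 < h \<and> \<omega> h = \<sigma> * sqrt (ln (real n) / (2 * real n * (LBINT t:{0<..h}. \<nu> t))))"

definition adaptive_rate :: "real \<Rightarrow> (real \<Rightarrow> real) \<Rightarrow> (real \<Rightarrow> real) \<Rightarrow> nat \<Rightarrow> real" where
  "adaptive_rate \<sigma> \<nu> \<omega> n = \<omega> (adaptive_bandwidth \<sigma> \<nu> \<omega> n)"

end

theory Submission
  imports Defs "HOL-Real_Asymp.Real_Asymp"
begin

text \<open>
  The proof compares two regression functions: \<open>0\<close>, which lies in the smoother class, and a bump of
  height \<open>a = \<tau> * adaptive_rate n\<close> on the ball around \<open>x0\<close> whose radius \<open>h\<close> is the adaptive bandwidth.
  For \<open>\<tau> \<le> 1\<close> the bump lies in the rougher class, because a constant approximates it on every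
  ball around \<open>x0\<close> within \<open>\<omega>1\<close> (\<open>step_bump_in_smoothness_class\<close>).

  Being minimax over the smoother class bounds the risk at \<open>0\<close> by a multiple of the \<open>p\<close>-th power
  of its minimax rate, which is smaller than the adaptive rate of the rougher class by a factor
  \<open>n powr - \<epsilon>\<close> (\<open>rate_gap\<close>). Hence, for large \<open>n\<close> and when the regression function is \<open>0\<close>, the event that the
  estimator exceeds \<open>a / 2\<close> in absolute value has probability at most a constant times
  \<open>n powr - (\<epsilon> * p)\<close>.

  The likelihood ratio of the bump against \<open>0\<close> has second moment at most
  \<open>exp (4 * n * G h * a\<^sup>2 / \<sigma>\<^sup>2)\<close>, where \<open>G h\<close> is the integral of \<open>\<nu>\<close> from 0 to \<open>h\<close>
  (\<open>step_second_moment\<close>). By the equation defining \<open>h\<close> this equals \<open>n powr (2 * \<tau>\<^sup>2)\<close>: the logarithm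
  in the adaptive rate is the price of a polynomial likelihood ratio. If \<open>\<tau>\<close> is small, the
  Cauchy-Schwarz inequality still gives that event probability at most 1/2 under the bump, so with
  probability at least 1/2 the estimator misses \<open>a\<close> by at least \<open>a / 2\<close>
  (\<open>two_point_risk_bound\<close>).

  The rate gap only needs \<open>G\<close> between two powers of \<open>h\<close> with exponents arbitrarily close to
  \<open>\<beta> + 1\<close> (\<open>mass_power_bounds\<close>).
\<close>

section \<open>Mass of a regularly varying profile near zero\<close>

text \<open>The integral of the profile over the interval from 0 to \<open>h\<close>: for small \<open>h\<close>, the mass
  that the design puts within distance \<open>h\<close> of the point, on one side of it.\<close>

definition profile_mass :: "(real \<Rightarrow> real) \<Rightarrow> real \<Rightarrow> real" where
  "profile_mass \<nu> h = (LBINT t:{0<..h}. \<nu> t)"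

lemma profile_integrable:
  fixes \<nu> :: "real \<Rightarrow> real"
  assumes cont: "continuous_on {0<..} \<nu>" and d: "0 < d"
    and fin: "(\<integral>\<^sup>+t. ennreal (\<nu> t) * indicator {0<..d} t \<partial>lborel) < \<infinity>"
    and nonneg: "\<And>t. 0 < t \<Longrightarrow> 0 \<le> \<nu> t"
  shows "set_integrable lborel {0<..h} \<nu>"
proof -
  have near: "set_integrable lborel {0<..d} \<nu>"
    unfolding set_integrable_def
  proof (rule integrableI_nonneg)
    show "(\<lambda>x. indicat_real {0<..d} x *\<^sub>R \<nu> x) \<in> borel_measurable lborel"
      using borel_measurable_continuous_on_indicator[OF _ continuous_on_subset[OF cont], of "{0<..d}"]
      by (simp add: subset_eq)
    show "AE x in lborel. 0 \<le> indicat_real {0<..d} x *\<^sub>R \<nu> x"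
      using nonneg by (auto simp: indicator_def)
    have "(\<integral>\<^sup>+x. ennreal (indicat_real {0<..d} x *\<^sub>R \<nu> x) \<partial>lborel)
        = (\<integral>\<^sup>+t. ennreal (\<nu> t) * indicator {0<..d} t \<partial>lborel)"
      by (intro nn_integral_cong) (auto simp: indicator_def)
    with fin show "(\<integral>\<^sup>+x. ennreal (indicat_real {0<..d} x *\<^sub>R \<nu> x) \<partial>lborel) < \<infinity>" by simp
  qed
  have "set_integrable lborel {d..max d h} \<nu>"
    by (rule borel_integrable_atLeastAtMost') (use d in \<open>auto intro: continuous_on_subset[OF cont]\<close>)
  with near have "set_integrable lborel ({0<..d} \<union> {d..max d h}) \<nu>"
    by (rule set_integrable_Un) auto
  then show ?thesis
    by (rule set_integrable_subset) auto
qed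

text \<open>A regularly varying profile of index greater than \<open>-1\<close>. The index alone makes \<open>\<nu>\<close> integrable
  near 0, but here integrability is assumed, because it is immediate for the profile of a
  probability density.\<close>

locale profile =
  fixes \<nu> :: "real \<Rightarrow> real" and \<beta> :: real
  assumes RV: "\<nu> \<in> RV \<beta>" and \<beta>: "-1 < \<beta>"
    and integrable: "\<And>h. set_integrable lborel {0<..h} \<nu>"
begin

abbreviation G :: "real \<Rightarrow> real" where "G \<equiv> profile_mass \<nu>"

lemma pos: "0 < t \<Longrightarrow> 0 < \<nu> t" and cont: "continuous_on {0<..} \<nu>"
  using RV unfolding RV_def by auto

lemma mass_split:
  assumes "0 < a" "a \<le> h"
  shows "G h = G a + integral {a..h} \<nu>"
proof -
  have i: "set_integrable lborel {a..h} \<nu>"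
    by (rule borel_integrable_atLeastAtMost') (use assms in \<open>auto intro: continuous_on_subset[OF cont]\<close>)
  have "AE x in lborel. \<not> (x \<in> {0<..a} \<and> x \<in> {a..h})"
    using AE_lborel_singleton[of a] by eventually_elim auto
  then have "G h = G a + (LBINT t:{a..h}. \<nu> t)"
    unfolding profile_mass_def using assms i integrable
    by (subst set_integral_Un_AE[symmetric]) (auto intro!: arg_cong[where f="\<lambda>S. set_lebesgue_integral lborel S \<nu>"])
  then show ?thesis
    using set_borel_integral_eq_integral[OF i] by simp
qed

lemma mass_nonneg: "0 \<le> G h"
  unfolding profile_mass_def set_lebesgue_integral_def
  by (rule integral_nonneg_AE) (use pos in \<open>auto simp: indicator_def less_imp_le\<close>)

lemma mass_strict_mono: "0 < a \<Longrightarrow> a < h \<Longrightarrow> G a < G h"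
proof -
  assume h: "0 < a" "a < h"
  have "continuous_on {a..h} \<nu>"
    by (rule continuous_on_subset[OF cont]) (use h in auto)
  then have "integral {a..h} (\<lambda>_. 0) < integral {a..h} \<nu>"
    using h pos by (intro integral_less_real) auto
  then show "G a < G h" using mass_split[of a h] h by simp
qed

lemma mass_pos: "0 < h \<Longrightarrow> 0 < G h"
  using mass_strict_mono[of "h/2" h] mass_nonneg[of "h/2"] by simp

lemma mass_mono: "0 < a \<Longrightarrow> a \<le> h \<Longrightarrow> G a \<le> G h"
  using mass_strict_mono[of a h] by (cases "a = h") auto

lemma mass_cont: "0 < a \<Longrightarrow> continuous_on {a..b} G"
proof -
  assume a: "0 < a"
  have "continuous_on {a..b} (\<lambda>x. G a + integral {a..x} \<nu>)"
    by (intro continuous_intros indefinite_integral_continuous_1 integrable_continuous_real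
        continuous_on_subset[OF cont]) (use a in auto)
  then show ?thesis
    by (rule continuous_on_eq) (metis mass_split a atLeastAtMost_iff)
qed

text \<open>Halving the radius multiplies the mass by about \<open>2 powr - (\<beta> + 1)\<close>: substitute \<open>t / 2\<close> for \<open>t\<close>
  in the integral and compare \<open>\<nu> (t / 2)\<close> with \<open>\<nu> t\<close> by regular variation at the single ratio 1/2.\<close>

lemma mass_halving:
  assumes "0 < \<eta>"
  obtains t0 where "0 < t0"
    "\<And>h. 0 < h \<Longrightarrow> h \<le> t0 \<Longrightarrow> 2 powr - (\<beta> + 1 + \<eta>) * G h \<le> G (h / 2)"
    "\<And>h. 0 < h \<Longrightarrow> h \<le> t0 \<Longrightarrow> G (h / 2) \<le> 2 powr - (\<beta> + 1 - \<eta>) * G h"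
proof -
  have lim: "((\<lambda>h. \<nu> (1/2 * h) / \<nu> h) \<longlongrightarrow> (1/2) powr \<beta>) (at_right 0)"
    using RV unfolding RV_def mem_Collect_eq by (meson half_gt_zero zero_less_one)
  have half: "(1/2) powr \<beta> = 2 powr - \<beta>" for \<beta> :: real
    by (simp add: powr_minus powr_divide field_simps)
  have "\<forall>\<^sub>F h in at_right 0. 2 powr - (\<beta> + \<eta>) < \<nu> (1/2 * h) / \<nu> h"
    by (rule order_tendstoD(1)[OF lim]) (use assms in \<open>simp add: half\<close>)
  moreover have "\<forall>\<^sub>F h in at_right 0. \<nu> (1/2 * h) / \<nu> h < 2 powr - (\<beta> - \<eta>)"
    by (rule order_tendstoD(2)[OF lim]) (use assms in \<open>simp add: half\<close>)
  ultimately have "\<forall>\<^sub>F h in at_right 0. 2 powr - (\<beta> + \<eta>) < \<nu> (1/2 * h) / \<nu> h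
      \<and> \<nu> (1/2 * h) / \<nu> h < 2 powr - (\<beta> - \<eta>)" by eventually_elim auto
  then obtain b where b: "0 < b" and
    B: "\<And>h. 0 < h \<Longrightarrow> h < b \<Longrightarrow> 2 powr - (\<beta> + \<eta>) < \<nu> (1/2 * h) / \<nu> h
      \<and> \<nu> (1/2 * h) / \<nu> h < 2 powr - (\<beta> - \<eta>)"
    unfolding eventually_at_right_field by auto
  have half_mass: "G (h / 2) = (LBINT t:{0<..h}. \<nu> (t / 2)) / 2"
    and half_int: "set_integrable lborel {0<..h} (\<lambda>t. \<nu> (t / 2))" if "0 < h" for h
  proof -
    have *: "indicat_real {0<..h/2} (0 + 1/2 * t) = indicat_real {0<..h} t" for t
      by (auto simp: indicator_def)
    show "G (h / 2) = (LBINT t:{0<..h}. \<nu> (t / 2)) / 2"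
      unfolding profile_mass_def set_lebesgue_integral_def
      by (subst lborel_integral_real_affine[where c="1/2" and t=0]) (use * in auto)
    show "set_integrable lborel {0<..h} (\<lambda>t. \<nu> (t / 2))"
      using lborel_integrable_real_affine[OF integrable[unfolded set_integrable_def], of "1/2" "h/2" 0] *
      unfolding set_integrable_def by simp
  qed
  have *: "2 powr - (\<beta> + \<eta>) * \<nu> t \<le> \<nu> (t / 2)" "\<nu> (t / 2) \<le> 2 powr - (\<beta> - \<eta>) * \<nu> t"
    if "0 < t" "t < b" for t
    using B[OF that] pos[OF that(1)] by (auto simp: field_simps)
  have e: "2 powr - (x + 1 + \<eta>) = 2 powr - (x + \<eta>) / 2"
    "2 powr - (x + 1 - \<eta>) = 2 powr - (x - \<eta>) / 2" for x :: real
    by (simp_all add: powr_diff powr_minus powr_add field_simps)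
  show ?thesis
  proof (rule that[of "b/2"])
    show "0 < b / 2" using b by simp
    fix h :: real assume h: "0 < h" "h \<le> b / 2"
    have "2 powr - (\<beta> + \<eta>) * G h = (LBINT t:{0<..h}. 2 powr - (\<beta> + \<eta>) * \<nu> t)"
      by (simp add: profile_mass_def)
    also have "\<dots> \<le> (LBINT t:{0<..h}. \<nu> (t / 2))"
      by (rule set_integral_mono) (use h * half_int integrable in \<open>auto intro!: set_integrable_mult_right\<close>)
    finally show "2 powr - (\<beta> + 1 + \<eta>) * G h \<le> G (h / 2)"
      unfolding e half_mass[OF h(1)] by simp
    have "(LBINT t:{0<..h}. \<nu> (t / 2)) \<le> (LBINT t:{0<..h}. 2 powr - (\<beta> - \<eta>) * \<nu> t)"
      by (rule set_integral_mono) (use h * half_int integrable in \<open>auto intro!: set_integrable_mult_right\<close>)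
    also have "\<dots> = 2 powr - (\<beta> - \<eta>) * G h"
      by (simp add: profile_mass_def)
    finally show "G (h / 2) \<le> 2 powr - (\<beta> + 1 - \<eta>) * G h"
      unfolding e half_mass[OF h(1)] by simp
  qed
qed

end

text \<open>A bound on the top dyadic shell that survives halving holds on the whole interval.\<close>

lemma dyadic_bound:
  fixes \<phi> :: "real \<Rightarrow> real"
  assumes t0: "0 < t0" and top: "\<And>h. t0 / 2 \<le> h \<Longrightarrow> h \<le> t0 \<Longrightarrow> \<phi> h \<le> C"
    and half: "\<And>h. 0 < h \<Longrightarrow> h \<le> t0 \<Longrightarrow> \<phi> (h / 2) \<le> \<phi> h"
    and h: "0 < h" "h \<le> t0"
  shows "\<phi> h \<le> C"
proof -
  have *: "t0 / 2 ^ Suc m \<le> h \<Longrightarrow> h \<le> t0 \<Longrightarrow> \<phi> h \<le> C" for m h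
  proof (induction m arbitrary: h)
    case 0
    then show ?case using top by simp
  next
    case (Suc m)
    show ?case
    proof (cases "t0 / 2 \<le> h")
      case True
      then show ?thesis using top Suc by simp
    next
      case False
      have "0 < t0 / 2 ^ Suc (Suc m)" using t0 by simp
      then have "0 < h" using Suc by linarith
      have "\<phi> (2 * h) \<le> C"
        by (rule Suc.IH) (use Suc.prems False in \<open>auto simp: field_simps\<close>)
      moreover have "\<phi> (2 * h / 2) \<le> \<phi> (2 * h)"
        by (rule half) (use \<open>0 < h\<close> False in auto)
      ultimately show ?thesis by simp
    qed
  qed
  obtain m :: nat where "t0 / h < 2 ^ m" using real_arch_pow[of 2 "t0/h"] by auto
  then have "t0 / 2 ^ Suc m \<le> h" using h t0 by (auto simp: field_simps)
  then show ?thesis using * h by blast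
qed

context profile begin

text \<open>A weak form of Potter's bounds. The quotients of \<open>G h\<close> by \<open>h powr (\<beta> + 1 - \<eta>)\<close> and of
  \<open>h powr (\<beta> + 1 + \<eta>)\<close> by \<open>G h\<close> do not increase when a small \<open>h\<close> is halved, and they are
  bounded on a compact dyadic shell.\<close>

lemma mass_power_bounds:
  assumes \<eta>: "0 < \<eta>"
  obtains t0 c C where "0 < t0" "0 < c" "0 < C"
    "\<And>h. 0 < h \<Longrightarrow> h \<le> t0 \<Longrightarrow> c * h powr (\<beta> + 1 + \<eta>) \<le> G h"
    "\<And>h. 0 < h \<Longrightarrow> h \<le> t0 \<Longrightarrow> G h \<le> C * h powr (\<beta> + 1 - \<eta>)"
proof -
  obtain t0 where t0: "0 < t0"
    and lo: "\<And>h. 0 < h \<Longrightarrow> h \<le> t0 \<Longrightarrow> 2 powr - (\<beta> + 1 + \<eta>) * G h \<le> G (h / 2)"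
    and hi: "\<And>h. 0 < h \<Longrightarrow> h \<le> t0 \<Longrightarrow> G (h / 2) \<le> 2 powr - (\<beta> + 1 - \<eta>) * G h"
    using mass_halving[OF \<eta>] by blast
  have bdd: "\<exists>C>0. \<forall>h\<in>{t0/2..t0}. G h / h powr e \<le> C \<and> h powr e / G h \<le> C" for e
  proof -
    have "continuous_on {t0/2..t0} (\<lambda>h. max (G h / h powr e) (h powr e / G h))"
      by (intro continuous_intros mass_cont ballI)
        (use t0 mass_pos in \<open>auto simp: less_imp_neq[symmetric]\<close>)
    then have "compact ((\<lambda>h. max (G h / h powr e) (h powr e / G h)) ` {t0/2..t0})"
      by (rule compact_continuous_image) simp
    then obtain B where "\<forall>y\<in>((\<lambda>h. max (G h / h powr e) (h powr e / G h)) ` {t0/2..t0}). \<bar>y\<bar> \<le> B"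
      using compact_imp_bounded bounded_real by blast
    then show ?thesis
      by (intro exI[of _ "max B 1"]) force
  qed
  have dbl: "(h / 2) powr e = h powr e * 2 powr - e" if "0 < h" for h e :: real
    using that by (simp add: powr_divide powr_minus field_simps)
  obtain C where C: "0 < C" "\<And>h. h\<in>{t0/2..t0} \<Longrightarrow> G h / h powr (\<beta> + 1 - \<eta>) \<le> C"
    using bdd by metis
  obtain D where D: "0 < D" "\<And>h. h\<in>{t0/2..t0} \<Longrightarrow> h powr (\<beta> + 1 + \<eta>) / G h \<le> D"
    using bdd by metis
  have hi': "G h / h powr (\<beta> + 1 - \<eta>) \<le> C" if "0 < h" "h \<le> t0" for h
  proof (rule dyadic_bound[OF t0 _ _ that])
    fix h assume h: "0 < h" "h \<le> t0"
    show "G (h / 2) / (h / 2) powr (\<beta> + 1 - \<eta>) \<le> G h / h powr (\<beta> + 1 - \<eta>)"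
      using hi[OF h] unfolding dbl[OF h(1)] using h(1) by (simp add: field_simps)
  qed (use C in auto)
  have lo': "h powr (\<beta> + 1 + \<eta>) / G h \<le> D" if "0 < h" "h \<le> t0" for h
  proof (rule dyadic_bound[OF t0 _ _ that])
    fix h assume h: "0 < h" "h \<le> t0"
    have "G (h/2) > 0" "G h > 0" using mass_pos h by auto
    then show "(h / 2) powr (\<beta> + 1 + \<eta>) / G (h / 2) \<le> h powr (\<beta> + 1 + \<eta>) / G h"
      using mult_left_mono[OF lo[OF h], of "h powr (\<beta> + 1 + \<eta>)"]
      unfolding dbl[OF h(1)] by (simp add: field_simps)
  qed (use D in auto)
  show ?thesis
  proof (rule that[of t0 "1/D" C])
    fix h assume h: "0 < h" "h \<le> t0"
    show "1 / D * h powr (\<beta> + 1 + \<eta>) \<le> G h"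
      using lo'[OF h] mass_pos[OF h(1)] D(1) by (simp add: field_simps)
    show "G h \<le> C * h powr (\<beta> + 1 - \<eta>)"
      using hi'[OF h] h(1) by (simp add: field_simps)
  qed (use t0 C D in auto)
qed

end

section \<open>Bandwidths and rates\<close>

context profile begin

lemma level_strict_mono:
  assumes "0 < r" "0 < s" "0 < a" "a < b"
  shows "(r * a powr s)\<^sup>2 * G a < (r * b powr s)\<^sup>2 * G b"
proof -
  have "a powr s < b powr s" using assms by (intro powr_less_mono2) auto
  then have "(r * a powr s)\<^sup>2 < (r * b powr s)\<^sup>2"
    using assms by (intro power_strict_mono) auto
  then show ?thesis
    using assms by (intro mult_strict_mono mass_strict_mono) (auto intro: less_imp_le mass_pos)
qed

text \<open>The point \<open>z\<close> below solves the equation with \<open>G 1\<close> in place of \<open>G h\<close>. By monotonicity of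
  \<open>G\<close>, the level \<open>v\<close> lies between the values of the left-hand side at \<open>z\<close> and at 1.\<close>

lemma level_exists:
  assumes "0 < r" "0 < s" "0 < v"
  shows "\<exists>!h. 0 < h \<and> (r * h powr s)\<^sup>2 * G h = v"
proof -
  let ?H = "\<lambda>h. (r * h powr s)\<^sup>2 * G h"
  define z where "z = (sqrt (v / G 1) / r) powr (1 / s)"
  have G1: "0 < G 1" by (rule mass_pos) simp
  have z: "0 < z" using assms G1 by (simp add: z_def)
  have zs: "(r * z powr s)\<^sup>2 = v / G 1"
    using assms G1 by (simp add: z_def powr_powr)
  have cont: "continuous_on {a..b} ?H" if "0 < a" for a b
    by (intro continuous_intros mass_cont) (use that in auto)
  have "\<exists>h>0. ?H h = v"
  proof (cases "z \<le> 1")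
    case True
    have "?H z \<le> v / G 1 * G 1"
      unfolding zs using mass_mono[OF z True] assms G1 by (intro mult_left_mono) auto
    moreover have "v / G 1 * G 1 \<le> ?H 1"
      unfolding zs[symmetric] using True z assms G1
      by (intro mult_right_mono power_mono) (auto intro: powr_le1)
    ultimately have "\<exists>h\<ge>z. h \<le> 1 \<and> ?H h = v"
      using True G1 by (intro IVT' cont z) auto
    then show ?thesis using z less_le_trans by metis
  next
    case False
    have "v / G 1 * G 1 \<le> ?H z"
      unfolding zs using mass_mono[of 1 z] False assms G1 by (intro mult_left_mono) auto
    moreover have "?H 1 \<le> v / G 1 * G 1"
      unfolding zs[symmetric] using False z assms G1
      by (intro mult_right_mono power_mono) (auto intro: ge_one_powr_ge_zero)
    ultimately have "\<exists>h\<ge>1. h \<le> z \<and> ?H h = v"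
      using False G1 by (intro IVT' cont) auto
    then show ?thesis by (metis less_le_trans zero_less_one)
  qed
  moreover have "a = b" if "0 < a" "?H a = v" "0 < b" "?H b = v" for a b
    using level_strict_mono[OF assms(1,2), of a b] level_strict_mono[OF assms(1,2), of b a] that
    by (cases a b rule: linorder_cases) auto
  ultimately show ?thesis by blast
qed

text \<open>Both bandwidth equations have the form \<open>r * h powr s = sqrt (v / G h)\<close>. As the solution is
  unique, the least solution exists and satisfies the squared equation.\<close>

lemma level_Least:
  assumes "0 < r" "0 < s" "0 < v"
    and eq: "\<And>h. 0 < h \<Longrightarrow> R h = sqrt (v / G h)"
  defines "h \<equiv> LEAST h. 0 < h \<and> r * h powr s = R h"
  shows "0 < h" "(r * h powr s)\<^sup>2 * G h = v"
proof -
  have *: "(0 < h \<and> r * h powr s = R h) \<longleftrightarrow> (0 < h \<and> (r * h powr s)\<^sup>2 * G h = v)" for h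
  proof (cases "0 < h")
    case True
    have "r * h powr s = sqrt (v / G h) \<longleftrightarrow> (r * h powr s)\<^sup>2 = v / G h"
      using assms True mass_pos[OF True] real_sqrt_unique[of "r * h powr s" "v / G h"] by auto
    then show ?thesis
      unfolding eq[OF True] using mass_pos[OF True] by (auto simp: field_simps)
  qed auto
  obtain k where k: "0 < k" "(r * k powr s)\<^sup>2 * G k = v"
    and u: "\<And>j. 0 < j \<and> (r * j powr s)\<^sup>2 * G j = v \<Longrightarrow> j = k"
    using level_exists[OF assms(1-3)] by blast
  have "h = k"
    unfolding h_def * by (rule Least_equality) (use k in blast, metis u order_refl)
  then show "0 < h" "(r * h powr s)\<^sup>2 * G h = v" using k by auto
qed

lemma minimax_bandwidth_level:
  assumes "0 < r" "0 < s" "0 < \<sigma>" "0 < n"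
  defines "h \<equiv> minimax_bandwidth \<sigma> \<nu> (\<lambda>h. r * h powr s) n"
  shows "0 < h" "(r * h powr s)\<^sup>2 * G h = \<sigma>\<^sup>2 / (2 * real n)"
proof -
  have *: "\<sigma> / sqrt (2 * real n * (LBINT t:{0<..h}. \<nu> t)) = sqrt (\<sigma>\<^sup>2 / (2 * real n) / G h)" for h
    using assms by (simp add: real_sqrt_divide profile_mass_def real_sqrt_mult)
  have v: "0 < \<sigma>\<^sup>2 / (2 * real n)" using assms by simp
  show "0 < h" "(r * h powr s)\<^sup>2 * G h = \<sigma>\<^sup>2 / (2 * real n)"
    using level_Least[OF assms(1,2) v *] by (simp_all add: h_def minimax_bandwidth_def)
qed

lemma adaptive_bandwidth_level:
  assumes "0 < r" "0 < s" "0 < \<sigma>" "2 \<le> n"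
  defines "h \<equiv> adaptive_bandwidth \<sigma> \<nu> (\<lambda>h. r * h powr s) n"
  shows "0 < h" "(r * h powr s)\<^sup>2 * G h = \<sigma>\<^sup>2 * ln (real n) / (2 * real n)"
proof -
  have *: "\<sigma> * sqrt (ln (real n) / (2 * real n * (LBINT t:{0<..h}. \<nu> t)))
      = sqrt (\<sigma>\<^sup>2 * ln (real n) / (2 * real n) / G h)" for h
    using assms by (simp add: real_sqrt_divide profile_mass_def real_sqrt_mult)
  have v: "0 < \<sigma>\<^sup>2 * ln (real n) / (2 * real n)" using assms by simp
  show "0 < h" "(r * h powr s)\<^sup>2 * G h = \<sigma>\<^sup>2 * ln (real n) / (2 * real n)"
    using level_Least[OF assms(1,2) v *] by (simp_all add: h_def adaptive_bandwidth_def)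
qed

lemma level_small:
  assumes "0 < r" "0 < s" "v \<longlonglongrightarrow> 0" "0 < t"
    and ev: "\<forall>\<^sub>F n in sequentially. 0 < h n \<and> (r * h n powr s)\<^sup>2 * G (h n) = v n"
  shows "\<forall>\<^sub>F n in sequentially. h n < t"
proof -
  have "0 < (r * t powr s)\<^sup>2 * G t" using assms mass_pos by simp
  then have "\<forall>\<^sub>F n in sequentially. v n < (r * t powr s)\<^sup>2 * G t"
    by (rule order_tendstoD(2)[OF assms(3)])
  with ev show ?thesis
  proof eventually_elim
    case (elim n)
    show ?case
    proof (rule ccontr)
      assume "\<not> h n < t"
      then have "(r * t powr s)\<^sup>2 * G t \<le> (r * h n powr s)\<^sup>2 * G (h n)"
        using level_strict_mono[OF assms(1,2,4), of "h n"] by (cases "h n = t") auto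
      with elim show False by auto
    qed
  qed
qed

lemma minimax_bandwidth_small:
  assumes "0 < r" "0 < s" "0 < \<sigma>" "0 < t"
  shows "\<forall>\<^sub>F n in sequentially. minimax_bandwidth \<sigma> \<nu> (\<lambda>h. r * h powr s) n < t"
proof (rule level_small[OF assms(1,2) _ assms(4)])
  show "(\<lambda>n. \<sigma>\<^sup>2 / (2 * real n)) \<longlonglongrightarrow> 0" by real_asymp
  show "\<forall>\<^sub>F n in sequentially. 0 < minimax_bandwidth \<sigma> \<nu> (\<lambda>h. r * h powr s) n \<and>
      (r * minimax_bandwidth \<sigma> \<nu> (\<lambda>h. r * h powr s) n powr s)\<^sup>2
        * G (minimax_bandwidth \<sigma> \<nu> (\<lambda>h. r * h powr s) n) = \<sigma>\<^sup>2 / (2 * real n)"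
    using eventually_gt_at_top[of 0] by eventually_elim (simp add: minimax_bandwidth_level[OF assms(1-3)])
qed

lemma adaptive_bandwidth_small:
  assumes "0 < r" "0 < s" "0 < \<sigma>" "0 < t"
  shows "\<forall>\<^sub>F n in sequentially. adaptive_bandwidth \<sigma> \<nu> (\<lambda>h. r * h powr s) n < t"
proof (rule level_small[OF assms(1,2) _ assms(4)])
  show "(\<lambda>n. \<sigma>\<^sup>2 * ln (real n) / (2 * real n)) \<longlonglongrightarrow> 0" by real_asymp
  show "\<forall>\<^sub>F n in sequentially. 0 < adaptive_bandwidth \<sigma> \<nu> (\<lambda>h. r * h powr s) n \<and>
      (r * adaptive_bandwidth \<sigma> \<nu> (\<lambda>h. r * h powr s) n powr s)\<^sup>2
        * G (adaptive_bandwidth \<sigma> \<nu> (\<lambda>h. r * h powr s) n) = \<sigma>\<^sup>2 * ln (real n) / (2 * real n)"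
    using eventually_ge_at_top[of 2] by eventually_elim (simp add: adaptive_bandwidth_level[OF assms(1-3)])
qed

lemma minimax_rate_upper:
  assumes "0 < r" "0 < s" "0 < \<sigma>" "0 < \<eta>"
  obtains K where "0 < K" "\<forall>\<^sub>F n in sequentially. minimax_rate \<sigma> \<nu> (\<lambda>h. r * h powr s) n
      \<le> K * real n powr - (s / (2 * s + (\<beta> + 1 + \<eta>)))"
proof -
  obtain t0 c C where t0: "0 < t0" "0 < c" "0 < C"
    and lo: "\<And>h. 0 < h \<Longrightarrow> h \<le> t0 \<Longrightarrow> c * h powr (\<beta> + 1 + \<eta>) \<le> G h"
    and "\<And>h. 0 < h \<Longrightarrow> h \<le> t0 \<Longrightarrow> G h \<le> C * h powr (\<beta> + 1 - \<eta>)"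
    by (rule mass_power_bounds[OF assms(4)]) (rule that)
  define d where "d = 2 * s + (\<beta> + 1 + \<eta>)"
  have d: "0 < d" using assms \<beta> by (simp add: d_def)
  define A where "A = \<sigma>\<^sup>2 / (2 * r\<^sup>2 * c)"
  have A: "0 < A" using assms t0 by (simp add: A_def)
  show ?thesis
  proof (rule that[of "r * A powr (s / d)"])
    show "0 < r * A powr (s / d)" using assms A by simp
    show "\<forall>\<^sub>F n in sequentially. minimax_rate \<sigma> \<nu> (\<lambda>h. r * h powr s) n
      \<le> r * A powr (s / d) * real n powr - (s / (2 * s + (\<beta> + 1 + \<eta>)))"
      using minimax_bandwidth_small[OF assms(1-3) t0(1)] eventually_gt_at_top[of 0]
    proof eventually_elim
      case (elim n)
      define h where "h = minimax_bandwidth \<sigma> \<nu> (\<lambda>h. r * h powr s) n"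
      have h: "0 < h" "(r * h powr s)\<^sup>2 * G h = \<sigma>\<^sup>2 / (2 * real n)" "h \<le> t0"
        using minimax_bandwidth_level[OF assms(1-3)] elim unfolding h_def by auto
      have sq: "(h powr s)\<^sup>2 = h powr (2 * s)" by (simp add: power2_eq_square flip: powr_add)
      have "r\<^sup>2 * c * h powr d = (r * h powr s)\<^sup>2 * (c * h powr (\<beta> + 1 + \<eta>))"
        unfolding d_def powr_add[of h "2 * s"] power_mult_distrib sq by simp
      also have "\<dots> \<le> (r * h powr s)\<^sup>2 * G h"
        by (intro mult_left_mono lo h) simp
      finally have "r\<^sup>2 * c * h powr d \<le> \<sigma>\<^sup>2 / (2 * real n)"
        using h(2) by simp
      then have "h powr d \<le> A / real n"
        using assms t0 elim by (simp add: A_def field_simps)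
      then have "(h powr d) powr (s / d) \<le> (A / real n) powr (s / d)"
        using assms d by (intro powr_mono2) auto
      then have "h powr s \<le> A powr (s / d) * real n powr - (s / d)"
        using d A elim by (simp add: powr_powr powr_divide powr_minus field_simps)
      then show ?case
        using assms unfolding minimax_rate_def h_def[symmetric] d_def[symmetric] by simp
    qed
  qed
qed

lemma adaptive_rate_lower:
  assumes "0 < r" "0 < s" "0 < \<sigma>" "0 < \<eta>" "\<eta> < \<beta> + 1"
  obtains K where "0 < K" "\<forall>\<^sub>F n in sequentially. K * real n powr - (s / (2 * s + (\<beta> + 1 - \<eta>)))
      \<le> adaptive_rate \<sigma> \<nu> (\<lambda>h. r * h powr s) n"
proof -
  obtain t0 c' c where t0: "0 < t0" "0 < c'" "0 < c"
    and "\<And>h. 0 < h \<Longrightarrow> h \<le> t0 \<Longrightarrow> c' * h powr (\<beta> + 1 + \<eta>) \<le> G h"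
    and hi: "\<And>h. 0 < h \<Longrightarrow> h \<le> t0 \<Longrightarrow> G h \<le> c * h powr (\<beta> + 1 - \<eta>)"
    by (rule mass_power_bounds[OF assms(4)]) (rule that)
  define d where "d = 2 * s + (\<beta> + 1 - \<eta>)"
  have d: "0 < d" using assms \<beta> by (simp add: d_def)
  define A where "A = \<sigma>\<^sup>2 / (2 * r\<^sup>2 * c)"
  have A: "0 < A" using assms t0 by (simp add: A_def)
  show ?thesis
  proof (rule that[of "r * A powr (s / d)"])
    show "0 < r * A powr (s / d)" using assms A by simp
    \<comment> \<open>The logarithm only enlarges the adaptive rate; the bound \<open>1 \<le> ln n\<close> is enough.\<close>
    have "\<forall>\<^sub>F n in sequentially. 1 \<le> ln (real n)" by real_asymp
    then show "\<forall>\<^sub>F n in sequentially. r * A powr (s / d) * real n powr - (s / (2 * s + (\<beta> + 1 - \<eta>)))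
        \<le> adaptive_rate \<sigma> \<nu> (\<lambda>h. r * h powr s) n"
      using adaptive_bandwidth_small[OF assms(1-3) t0(1)] eventually_ge_at_top[of 2]
    proof eventually_elim
      case (elim n)
      define h where "h = adaptive_bandwidth \<sigma> \<nu> (\<lambda>h. r * h powr s) n"
      have h: "0 < h" "(r * h powr s)\<^sup>2 * G h = \<sigma>\<^sup>2 * ln (real n) / (2 * real n)" "h \<le> t0"
        using adaptive_bandwidth_level[OF assms(1-3)] elim unfolding h_def by auto
      have sq: "(h powr s)\<^sup>2 = h powr (2 * s)" by (simp add: power2_eq_square flip: powr_add)
      have "\<sigma>\<^sup>2 / (2 * real n) \<le> \<sigma>\<^sup>2 * ln (real n) / (2 * real n)"
        using elim mult_left_mono[of 1 "ln (real n)" "\<sigma>\<^sup>2"] by (intro divide_right_mono) auto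
      also have "\<dots> = (r * h powr s)\<^sup>2 * G h" using h by simp
      also have "\<dots> \<le> (r * h powr s)\<^sup>2 * (c * h powr (\<beta> + 1 - \<eta>))"
        by (intro mult_left_mono hi h) simp
      also have "\<dots> = r\<^sup>2 * c * h powr d"
        unfolding d_def powr_add[of h "2 * s"] power_mult_distrib sq by simp
      finally have "A / real n \<le> h powr d"
        using assms t0 elim by (simp add: A_def field_simps)
      then have "(A / real n) powr (s / d) \<le> (h powr d) powr (s / d)"
        using assms d A by (intro powr_mono2) auto
      then have "A powr (s / d) * real n powr - (s / d) \<le> h powr s"
        using d A elim by (simp add: powr_powr powr_divide powr_minus field_simps)
      then show ?case
        using assms unfolding adaptive_rate_def h_def[symmetric] d_def[symmetric] by simp
    qed
  qed
qed

text \<open>The minimax rate over the smoother class is smaller than the adaptive rate over the rougher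
  class by a power of \<open>n\<close>. The exponents \<open>s / (2 * s + \<beta> + 1)\<close> of the two rates increase strictly
  in \<open>s\<close>, so there is room for the loss \<open>\<eta>\<close> in the power bounds on \<open>G\<close>.\<close>

lemma rate_gap:
  assumes "0 < r1" "0 < r2" "0 < s1" "s1 < s2" "0 < \<sigma>"
  obtains K \<epsilon> where "0 < K" "0 < \<epsilon>"
    "\<forall>\<^sub>F n in sequentially. minimax_rate \<sigma> \<nu> (\<lambda>h. r2 * h powr s2) n
        \<le> K * real n powr - \<epsilon> * adaptive_rate \<sigma> \<nu> (\<lambda>h. r1 * h powr s1) n"
proof -
  define b where "b = \<beta> + 1"
  have b: "0 < b" using \<beta> by (simp add: b_def)
  \<comment> \<open>The two exponents remain strictly ordered as long as \<open>\<eta> * (s1 + s2) < b * (s2 - s1)\<close>.\<close>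
  define \<eta> where "\<eta> = b * (s2 - s1) / (2 * (s1 + s2))"
  have \<eta>: "0 < \<eta>" using assms b by (simp add: \<eta>_def)
  have eq: "2 * (\<eta> * (s1 + s2)) = b * (s2 - s1)" using assms by (simp add: \<eta>_def field_simps)
  have "b * (s2 - s1) < b * (2 * (s1 + s2))" using b assms by (intro mult_strict_left_mono) auto
  then have \<eta>b: "\<eta> < b" using assms by (simp add: \<eta>_def pos_divide_less_eq)
  have "0 < b * (s2 - s1)" using b assms by simp
  then have "s1 * (2 * s2 + (b + \<eta>)) < s2 * (2 * s1 + (b - \<eta>))"
    using eq by (simp add: algebra_simps)
  then have gap: "s1 / (2 * s1 + (b - \<eta>)) < s2 / (2 * s2 + (b + \<eta>))"
    using assms b \<eta> \<eta>b by (simp add: divide_less_eq less_divide_eq mult_ac)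
  obtain K2 where K2: "0 < K2" "\<forall>\<^sub>F n in sequentially. minimax_rate \<sigma> \<nu> (\<lambda>h. r2 * h powr s2) n
      \<le> K2 * real n powr - (s2 / (2 * s2 + (b + \<eta>)))"
    using minimax_rate_upper[of r2 s2 \<sigma> \<eta>] assms \<eta> unfolding b_def by auto
  obtain K1 where K1: "0 < K1" "\<forall>\<^sub>F n in sequentially. K1 * real n powr - (s1 / (2 * s1 + (b - \<eta>)))
      \<le> adaptive_rate \<sigma> \<nu> (\<lambda>h. r1 * h powr s1) n"
    using adaptive_rate_lower[of r1 s1 \<sigma> \<eta>] assms \<eta> \<eta>b unfolding b_def by auto
  show ?thesis
  proof (rule that[of "K2 / K1" "s2 / (2 * s2 + (b + \<eta>)) - s1 / (2 * s1 + (b - \<eta>))"])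
    show "\<forall>\<^sub>F n in sequentially. minimax_rate \<sigma> \<nu> (\<lambda>h. r2 * h powr s2) n
        \<le> K2 / K1 * real n powr - (s2 / (2 * s2 + (b + \<eta>)) - s1 / (2 * s1 + (b - \<eta>)))
          * adaptive_rate \<sigma> \<nu> (\<lambda>h. r1 * h powr s1) n"
      using K1(2) K2(2)
    proof eventually_elim
      case (elim n)
      let ?e = "s2 / (2 * s2 + (b + \<eta>)) - s1 / (2 * s1 + (b - \<eta>))"
      have "K2 * real n powr - (s2 / (2 * s2 + (b + \<eta>)))
          = K2 / K1 * real n powr - ?e * (K1 * real n powr - (s1 / (2 * s1 + (b - \<eta>))))"
        using K1(1) by (simp flip: powr_add)
      also have "\<dots> \<le> K2 / K1 * real n powr - ?e * adaptive_rate \<sigma> \<nu> (\<lambda>h. r1 * h powr s1) n"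
        using elim K1 K2 by (intro mult_left_mono) auto
      finally show ?case using elim by simp
    qed
  qed (use K1 K2 gap in auto)
qed

end

section \<open>Likelihood ratios in Gaussian regression\<close>

lemma density_PiM:
  assumes "finite I" and [measurable]: "\<rho> \<in> borel_measurable M"
    and "sigma_finite_measure M" "sigma_finite_measure (density M \<rho>)"
  shows "(\<Pi>\<^sub>M i\<in>I. density M \<rho>) = density (\<Pi>\<^sub>M i\<in>I. M) (\<lambda>D. \<Prod>i\<in>I. \<rho> (D i))"
proof -
  interpret M: product_sigma_finite "\<lambda>_. M"
    using assms(3) by (simp add: product_sigma_finite_def)
  interpret N: product_sigma_finite "\<lambda>_. density M \<rho>"
    using assms(4) by (simp add: product_sigma_finite_def)
  have [measurable]: "(\<lambda>D. \<Prod>i\<in>I. \<rho> (D i)) \<in> borel_measurable (\<Pi>\<^sub>M i\<in>I. M)" by measurable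
  have "density (\<Pi>\<^sub>M i\<in>I. M) (\<lambda>D. \<Prod>i\<in>I. \<rho> (D i)) = (\<Pi>\<^sub>M i\<in>I. density M \<rho>)"
  proof (rule N.PiM_eqI[OF assms(1)])
    show "sets (density (\<Pi>\<^sub>M i\<in>I. M) (\<lambda>D. \<Prod>i\<in>I. \<rho> (D i))) = sets (\<Pi>\<^sub>M i\<in>I. density M \<rho>)"
      using sets_PiM_cong[of I I "\<lambda>_. M" "\<lambda>_. density M \<rho>"] by simp
    fix A assume A: "\<And>i. i \<in> I \<Longrightarrow> A i \<in> sets (density M \<rho>)"
    then have [measurable]: "Pi\<^sub>E I A \<in> sets (\<Pi>\<^sub>M i\<in>I. M)"
      using assms(1) by (intro sets_PiM_I_finite) auto
    have "emeasure (density (\<Pi>\<^sub>M i\<in>I. M) (\<lambda>D. \<Prod>i\<in>I. \<rho> (D i))) (Pi\<^sub>E I A)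
        = (\<integral>\<^sup>+D. (\<Prod>i\<in>I. \<rho> (D i)) * indicator (Pi\<^sub>E I A) D \<partial>(\<Pi>\<^sub>M i\<in>I. M))"
      by (rule emeasure_density) measurable
    also have "\<dots> = (\<integral>\<^sup>+D. (\<Prod>i\<in>I. \<rho> (D i) * indicator (A i) (D i)) \<partial>(\<Pi>\<^sub>M i\<in>I. M))"
    proof (rule nn_integral_cong)
      fix D assume "D \<in> space (\<Pi>\<^sub>M i\<in>I. M)"
      then have "indicator (Pi\<^sub>E I A) D = (\<Prod>i\<in>I. indicator (A i) (D i) :: ennreal)"
        using assms(1) by (auto simp: indicator_def space_PiM PiE_iff Pi_iff)
      then show "(\<Prod>i\<in>I. \<rho> (D i)) * indicator (Pi\<^sub>E I A) D = (\<Prod>i\<in>I. \<rho> (D i) * indicator (A i) (D i))"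
        by (simp add: prod.distrib)
    qed
    also have "\<dots> = (\<Prod>i\<in>I. \<integral>\<^sup>+x. \<rho> x * indicator (A i) x \<partial>M)"
      by (rule M.product_nn_integral_prod) (use assms(1) A in auto)
    also have "\<dots> = (\<Prod>i\<in>I. emeasure (density M \<rho>) (A i))"
      by (rule prod.cong) (use A in \<open>auto simp: emeasure_density\<close>)
    finally show "emeasure (density (\<Pi>\<^sub>M i\<in>I. M) (\<lambda>D. \<Prod>i\<in>I. \<rho> (D i))) (Pi\<^sub>E I A)
        = (\<Prod>i\<in>I. emeasure (density M \<rho>) (A i))" .
  qed
  then show ?thesis by simp
qed

text \<open>Two-point bound with the parameter values 0 (under \<open>M\<close>) and \<open>a\<close> (under \<open>density M L\<close>). A small
  risk at 0 makes the event \<open>a / 2 \<le> \<bar>\<tau>\<bar>\<close> so rare under \<open>M\<close> that, by the Cauchy-Schwarz inequality,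
  its probability under the alternative is at most 1/2. Off this event the loss at \<open>a\<close> is at least
  \<open>(a / 2) powr p\<close>.\<close>

lemma two_point_risk_bound:
  fixes \<tau> :: "'a \<Rightarrow> real"
  assumes [measurable]: "L \<in> borel_measurable M" "\<tau> \<in> borel_measurable M"
    and N: "prob_space (density M L)"
    and "0 < a" "0 < p" "0 \<le> Q" "0 \<le> R"
    and second: "(\<integral>\<^sup>+D. (L D)\<^sup>2 \<partial>M) \<le> ennreal Q"
    and risk: "(\<integral>\<^sup>+D. ennreal (\<bar>\<tau> D\<bar> powr p) \<partial>M) \<le> ennreal R"
    and small: "4 * Q * R \<le> (a / 2) powr p"
  shows "ennreal ((a / 2) powr p / 2) \<le> (\<integral>\<^sup>+D. ennreal (\<bar>\<tau> D - a\<bar> powr p) \<partial>density M L)"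
proof -
  interpret N: prob_space "density M L" by fact
  let ?c = "(a / 2) powr p"
  have c: "0 < ?c" using assms by simp
  define E where "E = {D \<in> space M. a / 2 \<le> \<bar>\<tau> D\<bar>}"
  have E[measurable]: "E \<in> sets M" unfolding E_def by measurable
  have "ennreal ?c * emeasure M E = (\<integral>\<^sup>+D. ennreal ?c * indicator E D \<partial>M)"
    by (simp add: nn_integral_cmult_indicator)
  also have "\<dots> \<le> (\<integral>\<^sup>+D. ennreal (\<bar>\<tau> D\<bar> powr p) \<partial>M)"
    using assms by (intro nn_integral_mono) (auto simp: indicator_def E_def intro!: ennreal_leI powr_mono2)
  finally have ME: "ennreal ?c * emeasure M E \<le> ennreal R" using risk by simp
  have "(emeasure (density M L) E)\<^sup>2 = (\<integral>\<^sup>+D. L D * indicator E D \<partial>M)\<^sup>2"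
    by (simp add: emeasure_density)
  also have "\<dots> \<le> (\<integral>\<^sup>+D. (L D)\<^sup>2 \<partial>M) * (\<integral>\<^sup>+D. (indicator E D)\<^sup>2 \<partial>M)"
    by (rule Cauchy_Schwarz_nn_integral) auto
  also have "(\<integral>\<^sup>+D. (indicator E D :: ennreal)\<^sup>2 \<partial>M) = emeasure M E"
  proof -
    have "(indicator E D :: ennreal)\<^sup>2 = indicator E D" for D by (simp add: indicator_def)
    then show ?thesis by simp
  qed
  finally have "(emeasure (density M L) E)\<^sup>2 \<le> ennreal Q * emeasure M E"
    using second by (meson mult_right_mono order_trans zero_le)
  then have "ennreal ?c * (emeasure (density M L) E)\<^sup>2 \<le> ennreal Q * (ennreal ?c * emeasure M E)"
    using mult_left_mono[of "(emeasure (density M L) E)\<^sup>2" "ennreal Q * emeasure M E" "ennreal ?c"]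
    by (simp add: mult_ac)
  also have "\<dots> \<le> ennreal Q * ennreal R"
    by (intro mult_left_mono ME) simp
  finally have "ennreal (?c * (N.prob E)\<^sup>2) \<le> ennreal (Q * R)"
    using assms c by (simp add: N.emeasure_eq_measure ennreal_mult' ennreal_power)
  then have "?c * (N.prob E)\<^sup>2 \<le> Q * R"
    using assms by (subst (asm) ennreal_le_iff) auto
  then have "?c * (4 * (N.prob E)\<^sup>2) \<le> ?c * 1" using small by simp
  then have "(2 * N.prob E)\<^sup>2 \<le> 1\<^sup>2" using c by (simp add: power_mult_distrib)
  then have PE: "N.prob E \<le> 1 / 2" using power2_le_imp_le[of "2 * N.prob E" 1] by simp
  have "1 / 2 \<le> N.prob (space M - E)"
    using N.prob_compl[of E] PE by simp
  then have "ennreal (?c / 2) \<le> ennreal ?c * emeasure (density M L) (space M - E)"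
    using c by (simp add: N.emeasure_eq_measure flip: ennreal_mult)
  also have "\<dots> = (\<integral>\<^sup>+D. ennreal ?c * indicator (space M - E) D \<partial>density M L)"
    by (subst nn_integral_cmult_indicator) auto
  also have "\<dots> \<le> (\<integral>\<^sup>+D. ennreal (\<bar>\<tau> D - a\<bar> powr p) \<partial>density M L)"
    using assms by (intro nn_integral_mono)
      (auto simp: indicator_def E_def not_le intro!: ennreal_leI powr_mono2)
  finally show ?thesis .
qed

lemma sets_pair_law [simp]: "sets (pair_law \<sigma> \<mu> f) = sets (borel \<Otimes>\<^sub>M borel)"
  by (simp add: pair_law_def)

lemma space_pair_law [simp]: "space (pair_law \<sigma> \<mu> f) = UNIV"
  by (simp add: pair_law_def space_pair_measure)

lemma measurable_pair_law_eq:
  "measurable (pair_law \<sigma> \<mu> f) N = measurable (borel \<Otimes>\<^sub>M borel) N"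
  by (rule measurable_cong_sets) auto

lemma nn_integral_normal_density:
  assumes "0 < \<sigma>"
  shows "(\<integral>\<^sup>+y. ennreal (normal_density m \<sigma> y) \<partial>lborel) = 1"
  using prob_space.emeasure_space_1[OF prob_space_normal_density[OF assms]]
  by (simp add: emeasure_density)

text \<open>Given \<open>X = x\<close>, the response is normal with mean \<open>f x\<close>.\<close>

lemma nn_integral_pair_law:
  assumes [measurable]: "\<mu> \<in> borel_measurable borel" "f \<in> borel_measurable borel"
    "g \<in> borel_measurable (borel \<Otimes>\<^sub>M borel)" and "0 < \<sigma>"
  shows "(\<integral>\<^sup>+z. g z \<partial>pair_law \<sigma> \<mu> f)
    = (\<integral>\<^sup>+x. ennreal (\<mu> x) * (\<integral>\<^sup>+y. ennreal (normal_density (f x) \<sigma> y) * g (x, y) \<partial>lborel) \<partial>lborel)"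
proof -
  let ?X = "density lborel (\<lambda>x. ennreal (\<mu> x))"
  let ?Z = "density lborel (\<lambda>z. ennreal (normal_density 0 \<sigma> z))"
  have [measurable]: "g \<in> borel_measurable (lborel \<Otimes>\<^sub>M lborel)"
    using assms(3) by (subst measurable_cong_sets[of _ "borel \<Otimes>\<^sub>M borel" borel borel])
      (auto intro!: sets_pair_measure_cong)
  have [measurable]: "(\<lambda>z. normal_density (f (fst z)) \<sigma> (snd z)) \<in> borel_measurable (lborel \<Otimes>\<^sub>M lborel)"
    unfolding normal_density_def by measurable
  interpret Z: prob_space ?Z by (rule prob_space_normal_density) fact
  have [simp]: "sets (?X \<Otimes>\<^sub>M ?Z) = sets (borel \<Otimes>\<^sub>M borel)"
    by (intro sets_pair_measure_cong) auto
  have m: "measurable (?X \<Otimes>\<^sub>M ?Z) N = measurable (borel \<Otimes>\<^sub>M borel) N" for N :: "'c measure"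
    by (rule measurable_cong_sets) auto
  have *: "(\<lambda>(x, \<xi>). (x, f x + \<xi>)) \<in> (?X \<Otimes>\<^sub>M ?Z) \<rightarrow>\<^sub>M (borel \<Otimes>\<^sub>M borel)"
    unfolding m by measurable
  have "(\<integral>\<^sup>+z. g z \<partial>pair_law \<sigma> \<mu> f) = (\<integral>\<^sup>+w. g (case w of (x, \<xi>) \<Rightarrow> (x, f x + \<xi>)) \<partial>(?X \<Otimes>\<^sub>M ?Z))"
    unfolding pair_law_def by (rule nn_integral_distr[OF *]) simp
  also have "\<dots> = (\<integral>\<^sup>+x. \<integral>\<^sup>+\<xi>. g (x, f x + \<xi>) \<partial>?Z \<partial>?X)"
    by (subst Z.nn_integral_fst[symmetric]) (auto simp: m)
  also have "\<dots> = (\<integral>\<^sup>+x. (\<integral>\<^sup>+\<xi>. ennreal (normal_density 0 \<sigma> \<xi>) * g (x, f x + \<xi>) \<partial>lborel) \<partial>?X)"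
    by (intro nn_integral_cong nn_integral_density) measurable
  also have "\<dots> = (\<integral>\<^sup>+x. (\<integral>\<^sup>+y. ennreal (normal_density (f x) \<sigma> y) * g (x, y) \<partial>lborel) \<partial>?X)"
  proof (rule nn_integral_cong)
    fix x
    have "(\<integral>\<^sup>+y. ennreal (normal_density (f x) \<sigma> y) * g (x, y) \<partial>lborel)
        = (\<integral>\<^sup>+\<xi>. ennreal (normal_density (f x) \<sigma> (f x + \<xi>)) * g (x, f x + \<xi>) \<partial>lborel)"
      by (subst nn_integral_real_affine[where c=1 and t="f x"]) auto
    then show "(\<integral>\<^sup>+\<xi>. ennreal (normal_density 0 \<sigma> \<xi>) * g (x, f x + \<xi>) \<partial>lborel)
        = (\<integral>\<^sup>+y. ennreal (normal_density (f x) \<sigma> y) * g (x, y) \<partial>lborel)"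
      by (simp add: normal_density_def)
  qed
  also have "\<dots> = (\<integral>\<^sup>+x. ennreal (\<mu> x) * (\<integral>\<^sup>+y. ennreal (normal_density (f x) \<sigma> y) * g (x, y) \<partial>lborel) \<partial>lborel)"
    by (rule nn_integral_density) measurable
  finally show ?thesis .
qed

text \<open>The likelihood ratio of one observation: regression function \<open>f\<close> against regression function 0.\<close>

definition gauss_ratio :: "real \<Rightarrow> (real \<Rightarrow> real) \<Rightarrow> real \<times> real \<Rightarrow> real" where
  "gauss_ratio \<sigma> f = (\<lambda>(x, y). exp ((2 * f x * y - (f x)\<^sup>2) / (2 * \<sigma>\<^sup>2)))"

lemma gauss_ratio_measurable [measurable]:
  assumes [measurable]: "f \<in> borel_measurable borel"
  shows "gauss_ratio \<sigma> f \<in> borel_measurable (borel \<Otimes>\<^sub>M borel)"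
  unfolding gauss_ratio_def by measurable

lemma normal_density_ratio:
  assumes "0 < \<sigma>"
  shows "normal_density 0 \<sigma> y * gauss_ratio \<sigma> f (x, y) = normal_density (f x) \<sigma> y"
proof -
  have "- y\<^sup>2 / (2 * \<sigma>\<^sup>2) + (2 * f x * y - (f x)\<^sup>2) / (2 * \<sigma>\<^sup>2) = - (y - f x)\<^sup>2 / (2 * \<sigma>\<^sup>2)"
    by (simp add: power2_diff diff_divide_distrib add_divide_distrib)
  then show ?thesis
    by (simp add: normal_density_def gauss_ratio_def flip: exp_add)
qed

lemma normal_density_ratio_squared:
  assumes "0 < \<sigma>"
  shows "normal_density 0 \<sigma> y * (gauss_ratio \<sigma> f (x, y))\<^sup>2
    = exp ((f x)\<^sup>2 / \<sigma>\<^sup>2) * normal_density (2 * f x) \<sigma> y"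
proof -
  have "- y\<^sup>2 / (2 * \<sigma>\<^sup>2) + 2 * ((2 * f x * y - (f x)\<^sup>2) / (2 * \<sigma>\<^sup>2))
     = (f x)\<^sup>2 / \<sigma>\<^sup>2 + - (y - 2 * f x)\<^sup>2 / (2 * \<sigma>\<^sup>2)"
    using assms by (simp add: field_simps power2_eq_square)
  then show ?thesis
    by (simp add: normal_density_def gauss_ratio_def exp_double[symmetric] flip: exp_add)
qed

lemma pair_law_density:
  assumes [measurable]: "\<mu> \<in> borel_measurable borel" "f \<in> borel_measurable borel" and \<sigma>: "0 < \<sigma>"
  shows "pair_law \<sigma> \<mu> f = density (pair_law \<sigma> \<mu> (\<lambda>_. 0)) (\<lambda>z. ennreal (gauss_ratio \<sigma> f z))"
proof (rule measure_eqI)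
  fix A assume "A \<in> sets (pair_law \<sigma> \<mu> f)"
  then have [measurable]: "A \<in> sets (borel \<Otimes>\<^sub>M borel)" by simp
  have "emeasure (pair_law \<sigma> \<mu> f) A = (\<integral>\<^sup>+z. indicator A z \<partial>pair_law \<sigma> \<mu> f)"
    by simp
  also have "\<dots> = (\<integral>\<^sup>+x. ennreal (\<mu> x) * (\<integral>\<^sup>+y. ennreal (normal_density (f x) \<sigma> y) * indicator A (x, y) \<partial>lborel) \<partial>lborel)"
    by (rule nn_integral_pair_law) (use \<sigma> in measurable)
  also have "\<dots> = (\<integral>\<^sup>+x. ennreal (\<mu> x) * (\<integral>\<^sup>+y. ennreal (normal_density 0 \<sigma> y)
      * (ennreal (gauss_ratio \<sigma> f (x, y)) * indicator A (x, y)) \<partial>lborel) \<partial>lborel)"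
    by (simp add: normal_density_ratio[OF \<sigma>, where f = f, symmetric] ennreal_mult' mult.assoc)
  also have "\<dots> = (\<integral>\<^sup>+z. ennreal (gauss_ratio \<sigma> f z) * indicator A z \<partial>pair_law \<sigma> \<mu> (\<lambda>_. 0))"
    by (rule nn_integral_pair_law[symmetric]) (use \<sigma> in measurable)
  also have "\<dots> = emeasure (density (pair_law \<sigma> \<mu> (\<lambda>_. 0)) (\<lambda>z. ennreal (gauss_ratio \<sigma> f z))) A"
    by (rule emeasure_density[symmetric]) (auto simp: measurable_pair_law_eq)
  finally show "emeasure (pair_law \<sigma> \<mu> f) A
      = emeasure (density (pair_law \<sigma> \<mu> (\<lambda>_. 0)) (\<lambda>z. ennreal (gauss_ratio \<sigma> f z))) A" .
qed simp

lemma prob_space_pair_law: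
  assumes "unit_density \<mu>" and [measurable]: "f \<in> borel_measurable borel" and "0 < \<sigma>"
  shows "prob_space (pair_law \<sigma> \<mu> f)"
proof
  have [measurable]: "\<mu> \<in> borel_measurable borel" using assms by (simp add: unit_density_def)
  have "emeasure (pair_law \<sigma> \<mu> f) (space (pair_law \<sigma> \<mu> f)) = (\<integral>\<^sup>+z. 1 \<partial>pair_law \<sigma> \<mu> f)"
    by simp
  also have "\<dots> = 1"
    using assms by (subst nn_integral_pair_law) (auto simp: nn_integral_normal_density unit_density_def)
  finally show "emeasure (pair_law \<sigma> \<mu> f) (space (pair_law \<sigma> \<mu> f)) = 1" .
qed

text \<open>The squared ratio turns the centred normal density into \<open>exp ((f x)\<^sup>2 / \<sigma>\<^sup>2)\<close> times the normal
  density with mean \<open>2 * f x\<close>, so the integral over the response is explicit.\<close>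

lemma ratio_second_moment:
  assumes [measurable]: "\<mu> \<in> borel_measurable borel" "f \<in> borel_measurable borel" and \<sigma>: "0 < \<sigma>"
  shows "(\<integral>\<^sup>+z. (ennreal (gauss_ratio \<sigma> f z))\<^sup>2 \<partial>pair_law \<sigma> \<mu> (\<lambda>_. 0))
    = (\<integral>\<^sup>+x. ennreal (\<mu> x) * ennreal (exp ((f x)\<^sup>2 / \<sigma>\<^sup>2)) \<partial>lborel)"
proof -
  have g: "0 \<le> gauss_ratio \<sigma> f z" for z
    by (simp add: gauss_ratio_def split: prod.split)
  have "ennreal (normal_density 0 \<sigma> y) * (ennreal (gauss_ratio \<sigma> f (x, y)))\<^sup>2
      = ennreal (exp ((f x)\<^sup>2 / \<sigma>\<^sup>2)) * ennreal (normal_density (2 * f x) \<sigma> y)" for x y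
    using normal_density_ratio_squared[OF \<sigma>, of y f x]
    by (simp add: ennreal_power g flip: ennreal_mult)
  then have "(\<integral>\<^sup>+y. ennreal (normal_density 0 \<sigma> y) * (ennreal (gauss_ratio \<sigma> f (x, y)))\<^sup>2 \<partial>lborel)
      = ennreal (exp ((f x)\<^sup>2 / \<sigma>\<^sup>2))" for x
    using \<sigma> by (simp add: nn_integral_cmult nn_integral_normal_density)
  then show ?thesis
    using \<sigma> by (subst nn_integral_pair_law) auto
qed

lemma sample_law_density:
  assumes \<mu>: "unit_density \<mu>" and [measurable]: "f \<in> borel_measurable borel" and \<sigma>: "0 < \<sigma>"
  shows "sample_law \<sigma> n \<mu> f = density (sample_law \<sigma> n \<mu> (\<lambda>_. 0))
    (\<lambda>D. \<Prod>i<n. ennreal (gauss_ratio \<sigma> f (D i)))"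
proof -
  have [measurable]: "\<mu> \<in> borel_measurable borel" using \<mu> by (simp add: unit_density_def)
  show ?thesis
    unfolding sample_law_def pair_law_density[OF \<open>\<mu> \<in> _\<close> \<open>f \<in> _\<close> \<sigma>]
    by (intro density_PiM prob_space_imp_sigma_finite prob_space_pair_law \<mu> \<sigma>)
      (auto simp: measurable_pair_law_eq pair_law_density[OF \<open>\<mu> \<in> _\<close> \<open>f \<in> _\<close> \<sigma>, symmetric]
        intro!: prob_space_imp_sigma_finite prob_space_pair_law \<mu> \<sigma>)
qed

lemma sample_second_moment:
  assumes \<mu>: "unit_density \<mu>" and [measurable]: "f \<in> borel_measurable borel" and \<sigma>: "0 < \<sigma>"
  shows "(\<integral>\<^sup>+D. (\<Prod>i<n. ennreal (gauss_ratio \<sigma> f (D i)))\<^sup>2 \<partial>sample_law \<sigma> n \<mu> (\<lambda>_. 0))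
    = (\<integral>\<^sup>+x. ennreal (\<mu> x) * ennreal (exp ((f x)\<^sup>2 / \<sigma>\<^sup>2)) \<partial>lborel) ^ n"
proof -
  have [measurable]: "\<mu> \<in> borel_measurable borel" using \<mu> by (simp add: unit_density_def)
  interpret prob_space "pair_law \<sigma> \<mu> (\<lambda>_. 0)"
    by (intro prob_space_pair_law \<mu> \<sigma>) simp
  interpret product_sigma_finite "\<lambda>_. pair_law \<sigma> \<mu> (\<lambda>_. 0)" ..
  have "(\<integral>\<^sup>+D. (\<Prod>i<n. ennreal (gauss_ratio \<sigma> f (D i)))\<^sup>2 \<partial>sample_law \<sigma> n \<mu> (\<lambda>_. 0))
    = (\<integral>\<^sup>+D. (\<Prod>i<n. (ennreal (gauss_ratio \<sigma> f (D i)))\<^sup>2) \<partial>(\<Pi>\<^sub>M i\<in>{..<n}. pair_law \<sigma> \<mu> (\<lambda>_. 0)))"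
    by (simp add: sample_law_def prod_power_distrib)
  also have "\<dots> = (\<Prod>i<n. \<integral>\<^sup>+z. (ennreal (gauss_ratio \<sigma> f z))\<^sup>2 \<partial>pair_law \<sigma> \<mu> (\<lambda>_. 0))"
    by (rule product_nn_integral_prod) (auto simp: measurable_pair_law_eq)
  finally show ?thesis
    by (simp add: ratio_second_moment[OF \<open>\<mu> \<in> _\<close> \<open>f \<in> _\<close> \<sigma>])
qed

section \<open>Risk at a bump around the point\<close>

text \<open>The alternative: height \<open>a\<close> on the closed ball of radius \<open>h\<close>, zero elsewhere.\<close>

definition step_bump :: "real \<Rightarrow> real \<Rightarrow> real \<Rightarrow> real \<Rightarrow> real" where
  "step_bump x0 h a = (\<lambda>x. if \<bar>x - x0\<bar> \<le> h then a else 0)"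

lemma step_bump_measurable [measurable]: "step_bump x0 h a \<in> borel_measurable borel"
  unfolding step_bump_def by measurable

text \<open>Although discontinuous, the bump belongs to the class: the class restricts \<open>f\<close> only through
  its approximation on balls centred at \<open>x0\<close>. The constant \<open>a\<close> is exact on balls of radius at most
  \<open>h\<close> and has error at most \<open>a\<close> on larger ones.\<close>

lemma step_bump_in_smoothness_class:
  assumes "0 < s" "0 \<le> a" "\<And>t. h < t \<Longrightarrow> a \<le> \<omega> t"
  shows "step_bump x0 h a \<in> smoothness_class \<delta> x0 s \<omega>"
proof -
  have "(INF P\<in>{P. int (degree P) \<le> strict_floor s}.
        SUP x\<in>{x. \<bar>x - x0\<bar> \<le> t}. ennreal \<bar>step_bump x0 h a x - poly P (x - x0)\<bar>) \<le> ennreal (\<omega> t)"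
    if "0 < t" for t
  proof (rule INF_lower2[of "[:a:]"])
    show "[:a:] \<in> {P. int (degree P) \<le> strict_floor s}"
      using assms(1) by (simp add: strict_floor_eq_ceiling)
    show "(SUP x\<in>{x. \<bar>x - x0\<bar> \<le> t}. ennreal \<bar>step_bump x0 h a x - poly [:a:] (x - x0)\<bar>) \<le> ennreal (\<omega> t)"
      using assms(2,3) by (intro SUP_least) (auto simp: step_bump_def intro!: ennreal_leI)
  qed
  then show ?thesis by (simp add: smoothness_class_def)
qed

lemma design_neighbourhood:
  assumes "local_profile x0 W \<beta> \<mu> \<nu>" "x0 \<in> interior W"
  obtains d where "0 < d" "\<And>x. x \<in> {0..1} \<Longrightarrow> x \<noteq> x0 \<Longrightarrow> \<bar>x - x0\<bar> \<le> d \<Longrightarrow> \<mu> x = \<nu> \<bar>x - x0\<bar>"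
proof -
  obtain d where "0 < d" "cball x0 d \<subseteq> W"
    using assms(2) mem_interior_cball by blast
  with assms(1) that[of d] show ?thesis
    unfolding local_profile_def by (force simp: dist_real_def abs_minus_commute)
qed

text \<open>At least one side of \<open>x0\<close> lies in the unit interval; there the total mass 1 of the density
  bounds the integral of the profile.\<close>

lemma profile_of_design:
  assumes \<mu>: "unit_density \<mu>" and loc: "local_profile x0 W \<beta> \<mu> \<nu>" and x0: "x0 \<in> interior W" "x0 \<in> {0..1}"
    and "-1 < \<beta>"
  shows "profile \<nu> \<beta>"
proof
  show RV: "\<nu> \<in> RV \<beta>" using loc by (simp add: local_profile_def)
  have [measurable]: "\<mu> \<in> borel_measurable borel" using \<mu> by (simp add: unit_density_def)
  obtain d where d: "0 < d"
    "\<And>x. x \<in> {0..1} \<Longrightarrow> x \<noteq> x0 \<Longrightarrow> \<bar>x - x0\<bar> \<le> d \<Longrightarrow> \<mu> x = \<nu> \<bar>x - x0\<bar>"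
    using design_neighbourhood[OF loc x0(1)] by blast
  \<comment> \<open>The direction pointing from \<open>x0\<close> into the unit interval.\<close>
  define c :: real where "c = (if x0 < 1 then 1 else -1)"
  define e where "e = min d (if x0 < 1 then 1 - x0 else 1)"
  have e: "0 < e" using d x0 by (auto simp: e_def)
  have eq: "\<mu> (x0 + c * t) = \<nu> t" if "0 < t" "t \<le> e" for t
    using d(2)[of "x0 + c * t"] that x0 by (auto simp: c_def e_def split: if_splits)
  have "(\<integral>\<^sup>+t. ennreal (\<nu> t) * indicator {0<..e} t \<partial>lborel) \<le> (\<integral>\<^sup>+t. ennreal (\<mu> (x0 + c * t)) \<partial>lborel)"
    by (intro nn_integral_mono) (auto simp: indicator_def eq)
  also have "\<dots> = (\<integral>\<^sup>+x. ennreal (\<mu> x) \<partial>lborel)"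
    by (subst nn_integral_real_affine[of _ c x0]) (auto simp: c_def)
  also have "\<dots> < \<infinity>" using \<mu> by (simp add: unit_density_def)
  finally show "set_integrable lborel {0<..h} \<nu>" for h
    using RV e by (intro profile_integrable[of \<nu> e]) (auto simp: RV_def less_imp_le)
qed fact

lemma ball_mass_bound:
  assumes "profile \<nu> \<beta>" and \<mu>: "unit_density \<mu>"
    and d: "\<And>x. x \<in> {0..1} \<Longrightarrow> x \<noteq> x0 \<Longrightarrow> \<bar>x - x0\<bar> \<le> h \<Longrightarrow> \<mu> x = \<nu> \<bar>x - x0\<bar>"
  shows "(\<integral>\<^sup>+x. ennreal (\<mu> x) * indicator {x. \<bar>x - x0\<bar> \<le> h} x \<partial>lborel) \<le> ennreal (2 * profile_mass \<nu> h)"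
proof -
  interpret profile \<nu> \<beta> by fact
  define k where "k t = indicat_real {0<..h} t * \<nu> t" for t
  have i: "integrable lborel k"
    using integrable[of h] by (simp add: set_integrable_def k_def[abs_def])
  have [measurable]: "k \<in> borel_measurable borel"
    using borel_measurable_integrable[OF i] by simp
  have k0: "0 \<le> k t" for t
    using pos[of t] by (auto simp: k_def indicator_def)
  have ik: "(\<integral>\<^sup>+t. ennreal (k t) \<partial>lborel) = ennreal (G h)"
    by (subst nn_integral_eq_integral[OF i])
      (use k0 in \<open>auto simp: profile_mass_def set_lebesgue_integral_def k_def[abs_def]\<close>)
  have "(\<integral>\<^sup>+x. ennreal (\<mu> x) * indicator {x. \<bar>x - x0\<bar> \<le> h} x \<partial>lborel)
      \<le> (\<integral>\<^sup>+x. ennreal (k (x - x0)) + ennreal (k (x0 - x)) \<partial>lborel)"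
  proof (rule nn_integral_mono_AE)
    show "AE x in lborel. ennreal (\<mu> x) * indicator {x. \<bar>x - x0\<bar> \<le> h} x
        \<le> ennreal (k (x - x0)) + ennreal (k (x0 - x))"
      using AE_lborel_singleton[of x0]
    proof eventually_elim
      case (elim x)
      show ?case
      proof (cases "x \<in> {0..1} \<and> \<bar>x - x0\<bar> \<le> h")
        case True
        then show ?thesis
          using d[of x] elim by (cases "x0 < x") (auto simp: k_def indicator_def)
      next
        case False
        then show ?thesis using \<mu> by (auto simp: unit_density_def indicator_def)
      qed
    qed
  qed
  also have "\<dots> = (\<integral>\<^sup>+x. ennreal (k (x - x0)) \<partial>lborel) + (\<integral>\<^sup>+x. ennreal (k (x0 - x)) \<partial>lborel)"
    by (rule nn_integral_add) auto
  also have "(\<integral>\<^sup>+x. ennreal (k (x - x0)) \<partial>lborel) = ennreal (G h)"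
    unfolding ik[symmetric] by (subst nn_integral_real_affine[where c=1 and t="- x0" and f = "\<lambda>x. ennreal (k x)"]) auto
  also have "(\<integral>\<^sup>+x. ennreal (k (x0 - x)) \<partial>lborel) = ennreal (G h)"
    unfolding ik[symmetric] by (subst nn_integral_real_affine[where c="-1" and t="x0" and f = "\<lambda>x. ennreal (k x)"]) auto
  finally show ?thesis
    using mass_nonneg[of h] by (simp flip: ennreal_plus)
qed

text \<open>Observations outside the ball carry no information. One observation contributes a factor
  exceeding 1 by at most the mass of the ball times \<open>exp (a\<^sup>2 / \<sigma>\<^sup>2) - 1\<close>, and
  \<open>exp z - 1 \<le> 2 * z\<close> for \<open>z \<le> 1\<close>, that is, for a bump no higher than the noise level.\<close>

lemma step_second_moment:
  assumes prof: "profile \<nu> \<beta>" and \<mu>: "unit_density \<mu>" and \<sigma>: "0 < \<sigma>"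
    and d: "\<And>x. x \<in> {0..1} \<Longrightarrow> x \<noteq> x0 \<Longrightarrow> \<bar>x - x0\<bar> \<le> h \<Longrightarrow> \<mu> x = \<nu> \<bar>x - x0\<bar>"
    and a: "a\<^sup>2 \<le> \<sigma>\<^sup>2"
  shows "(\<integral>\<^sup>+D. (\<Prod>i<n. ennreal (gauss_ratio \<sigma> (step_bump x0 h a) (D i)))\<^sup>2 \<partial>sample_law \<sigma> n \<mu> (\<lambda>_. 0))
    \<le> ennreal (exp (4 * real n * profile_mass \<nu> h * a\<^sup>2 / \<sigma>\<^sup>2))"
proof -
  have [measurable]: "\<mu> \<in> borel_measurable borel" using \<mu> by (simp add: unit_density_def)
  have G: "0 \<le> profile_mass \<nu> h" by (rule profile.mass_nonneg[OF prof])
  define z where "z = a\<^sup>2 / \<sigma>\<^sup>2"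
  have z: "0 \<le> z" "z \<le> 1" using a \<sigma> by (auto simp: z_def)
  define u where "u = (exp z - 1) * (2 * profile_mass \<nu> h)"
  have "z\<^sup>2 \<le> z" using z by (simp add: power2_eq_square mult_left_le)
  then have e: "exp z - 1 \<le> 2 * z" using exp_bound[OF z] by simp
  have u: "0 \<le> u" using z G by (simp add: u_def)
  have "(\<integral>\<^sup>+x. ennreal (\<mu> x) * ennreal (exp ((step_bump x0 h a x)\<^sup>2 / \<sigma>\<^sup>2)) \<partial>lborel)
     = (\<integral>\<^sup>+x. ennreal (\<mu> x) + ennreal (exp z - 1) * (ennreal (\<mu> x) * indicator {x. \<bar>x - x0\<bar> \<le> h} x) \<partial>lborel)"
  proof (rule nn_integral_cong)
    fix x
    have "0 \<le> \<mu> x" using \<mu> by (simp add: unit_density_def)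
    then have "ennreal (\<mu> x) * ennreal (exp z) = ennreal (\<mu> x + (exp z - 1) * \<mu> x)"
      by (simp add: algebra_simps flip: ennreal_mult)
    also have "\<dots> = ennreal (\<mu> x) + ennreal (exp z - 1) * ennreal (\<mu> x)"
      using z(1) \<open>0 \<le> \<mu> x\<close> by (simp add: ennreal_mult)
    finally show "ennreal (\<mu> x) * ennreal (exp ((step_bump x0 h a x)\<^sup>2 / \<sigma>\<^sup>2))
      = ennreal (\<mu> x) + ennreal (exp z - 1) * (ennreal (\<mu> x) * indicator {x. \<bar>x - x0\<bar> \<le> h} x)"
      by (simp add: step_bump_def flip: z_def)
  qed
  also have "\<dots> = (\<integral>\<^sup>+x. ennreal (\<mu> x) \<partial>lborel)
      + ennreal (exp z - 1) * (\<integral>\<^sup>+x. ennreal (\<mu> x) * indicator {x. \<bar>x - x0\<bar> \<le> h} x \<partial>lborel)"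
    by (simp add: nn_integral_add nn_integral_cmult)
  also have "\<dots> \<le> 1 + ennreal (exp z - 1) * ennreal (2 * profile_mass \<nu> h)"
    using \<mu> by (intro add_mono mult_left_mono ball_mass_bound[OF prof \<mu> d]) (auto simp: unit_density_def)
  also have "\<dots> = ennreal (1 + u)"
    using z G by (simp add: u_def ennreal_mult)
  finally have one: "(\<integral>\<^sup>+x. ennreal (\<mu> x) * ennreal (exp ((step_bump x0 h a x)\<^sup>2 / \<sigma>\<^sup>2)) \<partial>lborel) \<le> ennreal (1 + u)" .
  have "(\<integral>\<^sup>+D. (\<Prod>i<n. ennreal (gauss_ratio \<sigma> (step_bump x0 h a) (D i)))\<^sup>2 \<partial>sample_law \<sigma> n \<mu> (\<lambda>_. 0))
      \<le> ennreal (1 + u) ^ n"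
    unfolding sample_second_moment[OF \<mu> step_bump_measurable \<sigma>] by (rule power_mono[OF one]) simp
  also have "\<dots> = ennreal ((1 + u) ^ n)"
    by (rule ennreal_power) (use u in simp)
  also have "(1 + u) ^ n \<le> exp u ^ n"
    using u exp_ge_add_one_self[of u] by (intro power_mono) auto
  also have "\<dots> = exp (real n * u)"
    by (simp add: exp_of_nat_mult)
  also have "real n * u \<le> real n * (2 * z * (2 * profile_mass \<nu> h))"
    unfolding u_def using e G by (intro mult_left_mono mult_right_mono) auto
  also have "\<dots> = 4 * real n * profile_mass \<nu> h * a\<^sup>2 / \<sigma>\<^sup>2"
    by (simp add: z_def)
  finally show ?thesis by (simp add: ennreal_leI)
qed

lemma bump_risk_lower:
  assumes prof: "profile \<nu> \<beta>" and \<mu>: "unit_density \<mu>" and \<sigma>: "0 < \<sigma>" and p: "0 < p"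
    and d: "\<And>x. x \<in> {0..1} \<Longrightarrow> x \<noteq> x0 \<Longrightarrow> \<bar>x - x0\<bar> \<le> h \<Longrightarrow> \<mu> x = \<nu> \<bar>x - x0\<bar>"
    and T: "estimator_at x0 T" and "0 < h" "0 < a" "a\<^sup>2 \<le> \<sigma>\<^sup>2" "0 \<le> R"
    and risk0: "pointwise_risk x0 \<sigma> p \<mu> T n (\<lambda>_. 0) \<le> ennreal R"
    and small: "4 * exp (4 * real n * profile_mass \<nu> h * a\<^sup>2 / \<sigma>\<^sup>2) * R \<le> (a / 2) powr p"
  shows "ennreal ((a / 2) powr p / 2) \<le> pointwise_risk x0 \<sigma> p \<mu> T n (step_bump x0 h a)"
proof -
  let ?M = "sample_law \<sigma> n \<mu> (\<lambda>_. 0)"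
  let ?L = "\<lambda>D. \<Prod>i<n. ennreal (gauss_ratio \<sigma> (step_bump x0 h a) (D i))"
  have s: "sets (sample_law \<sigma> n \<mu> f) = sets (\<Pi>\<^sub>M i\<in>{..<n}. borel \<Otimes>\<^sub>M borel)" for f
    unfolding sample_law_def by (rule sets_PiM_cong) auto
  have mm: "measurable ?M N = measurable (\<Pi>\<^sub>M i\<in>{..<n}. borel \<Otimes>\<^sub>M borel) N" for N :: "'c measure"
    by (rule measurable_cong_sets) (auto simp: s)
  have "prob_space (sample_law \<sigma> n \<mu> (step_bump x0 h a))"
    unfolding sample_law_def by (intro prob_space_PiM prob_space_pair_law \<mu> \<sigma>) auto
  then have N: "prob_space (density ?M ?L)"
    by (simp only: sample_law_density[OF \<mu> step_bump_measurable \<sigma>, symmetric])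
  have "ennreal ((a / 2) powr p / 2) \<le> (\<integral>\<^sup>+D. ennreal (\<bar>T n D x0 - a\<bar> powr p) \<partial>density ?M ?L)"
  proof (rule two_point_risk_bound[OF _ _ N])
    show "?L \<in> borel_measurable ?M" unfolding mm by measurable
    show "(\<lambda>D. T n D x0) \<in> borel_measurable ?M" unfolding mm using T by (simp add: estimator_at_def)
    show "(\<integral>\<^sup>+D. (?L D)\<^sup>2 \<partial>?M) \<le> ennreal (exp (4 * real n * profile_mass \<nu> h * a\<^sup>2 / \<sigma>\<^sup>2))"
      using d by (intro step_second_moment[OF prof \<mu> \<sigma>] assms) auto
    show "(\<integral>\<^sup>+D. ennreal (\<bar>T n D x0\<bar> powr p) \<partial>?M) \<le> ennreal R"
      using risk0 by (simp add: pointwise_risk_def)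
  qed (use assms in auto)
  also have "\<dots> = pointwise_risk x0 \<sigma> p \<mu> T n (step_bump x0 h a)"
    unfolding pointwise_risk_def sample_law_density[OF \<mu> step_bump_measurable \<sigma>]
    using \<open>0 < h\<close> by (simp add: step_bump_def)
  finally show ?thesis .
qed

theorem corollary1:
  fixes r1 r2 s1 s2 \<delta> p \<beta> \<sigma> x0 :: real
    and k :: int
    and W :: "real set"
    and \<mu> \<nu> \<omega>1 \<omega>2 :: "real \<Rightarrow> real"
    and F1 F2 :: "(real \<Rightarrow> real) set"
    and T :: "nat \<Rightarrow> (nat \<Rightarrow> real \<times> real) \<Rightarrow> real \<Rightarrow> real"
  assumes "\<sigma> > 0" "x0 \<in> {0..1}"
    and "0 < r2" "r2 < r1"
    and "0 < s1" "s1 < s2" "strict_floor s1 = k" "strict_floor s2 = k"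
    and "0 < \<delta>" "\<delta> \<le> 1" "p > 1"
    and "\<beta> > -1" "x0 \<in> interior W"
    and "\<mu> \<in> design_class x0 W \<beta>" "local_profile x0 W \<beta> \<mu> \<nu>"
    and "\<omega>1 = (\<lambda>h. r1 * h powr s1)" "\<omega>2 = (\<lambda>h. r2 * h powr s2)"
    and "F1 = smoothness_class \<delta> x0 s1 \<omega>1" "F2 = smoothness_class \<delta> x0 s2 \<omega>2"
    and "estimator_at x0 T"
    and "limsup (\<lambda>n. max_risk x0 \<sigma> p \<mu> T F1 (minimax_rate \<sigma> \<nu> \<omega>1) n) < \<infinity>"
    and "limsup (\<lambda>n. max_risk x0 \<sigma> p \<mu> T F2 (minimax_rate \<sigma> \<nu> \<omega>2) n) < \<infinity>"
  shows "liminf (\<lambda>n. max_risk x0 \<sigma> p \<mu> T F1 (adaptive_rate \<sigma> \<nu> \<omega>1) n) > 0"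
proof -
  note \<sigma> = \<open>\<sigma> > 0\<close> and p = \<open>p > 1\<close>
  have rs: "0 < r1" "0 < r2" "0 < s1" "0 < s2" using assms by auto
  have \<mu>: "unit_density \<mu>" using assms by (simp add: design_class_def)
  have prof: "profile \<nu> \<beta>" using assms \<mu> by (intro profile_of_design) auto
  interpret profile \<nu> \<beta> by (rule prof)
  obtain d where d: "0 < d"
    "\<And>x. x \<in> {0..1} \<Longrightarrow> x \<noteq> x0 \<Longrightarrow> \<bar>x - x0\<bar> \<le> d \<Longrightarrow> \<mu> x = \<nu> \<bar>x - x0\<bar>"
    using design_neighbourhood assms by blast
  define \<psi> where "\<psi> = minimax_rate \<sigma> \<nu> \<omega>2"
  define \<rho> where "\<rho> = adaptive_rate \<sigma> \<nu> \<omega>1"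
  define h where "h = adaptive_bandwidth \<sigma> \<nu> \<omega>1"
  obtain K \<epsilon> where K: "0 < K" "0 < \<epsilon>"
    and gap: "\<forall>\<^sub>F n in sequentially. \<psi> n \<le> K * real n powr - \<epsilon> * \<rho> n"
    using rate_gap[OF rs(1,2,3) \<open>s1 < s2\<close> \<sigma>] unfolding \<psi>_def \<rho>_def assms by blast
  obtain C where C: "0 \<le> C" "limsup (\<lambda>n. max_risk x0 \<sigma> p \<mu> T F2 \<psi> n) < ennreal C"
  proof (cases "limsup (\<lambda>n. max_risk x0 \<sigma> p \<mu> T F2 \<psi> n)")
    case (real r)
    then show ?thesis using that[of "r + 1"] by (simp add: ennreal_lessI)
  qed (use assms(22) in \<open>simp add: \<psi>_def\<close>)
  have risk2: "\<forall>\<^sub>F n in sequentially. max_risk x0 \<sigma> p \<mu> T F2 \<psi> n < ennreal C"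
    by (rule Limsup_lessD[OF C(2)])
  \<comment> \<open>With \<open>a = \<tau> * \<rho> n\<close> the second moment of the likelihood ratio is at most \<open>n powr (2 * \<tau>\<^sup>2)\<close>,
      while the risk at 0 relative to \<open>a powr p\<close> is of order \<open>n powr - (\<epsilon> * p)\<close>; this \<open>\<tau>\<close> lets the
      second factor win.\<close>
  define \<tau> where "\<tau> = min 1 (sqrt (\<epsilon> * p / 4))"
  have \<tau>: "0 < \<tau>" "\<tau> \<le> 1" using K p by (auto simp: \<tau>_def)
  have "\<tau>\<^sup>2 \<le> (sqrt (\<epsilon> * p / 4))\<^sup>2" using \<tau> by (intro power_mono) (auto simp: \<tau>_def)
  then have \<tau>2: "2 * \<tau>\<^sup>2 - \<epsilon> * p < 0" using K p by (simp add: algebra_simps) (smt (verit) mult_pos_pos)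
  have "((\<lambda>n. 4 * C * K powr p * real n powr (2 * \<tau>\<^sup>2 - \<epsilon> * p)) \<longlonglongrightarrow> 4 * C * K powr p * 0)"
    by (intro tendsto_intros tendsto_neg_powr \<tau>2 filterlim_real_sequentially)
  then have small: "\<forall>\<^sub>F n in sequentially. 4 * C * K powr p * real n powr (2 * \<tau>\<^sup>2 - \<epsilon> * p) < (\<tau> / 2) powr p"
    by (rule order_tendstoD(2)) (use \<tau> in auto)
  \<comment> \<open>Radii below \<open>t0\<close> keep the bump no higher than the noise level.\<close>
  define t0 where "t0 = (\<sigma> / r1) powr (1 / s1)"
  have t0: "0 < t0" "r1 * t0 powr s1 = \<sigma>" using \<sigma> rs by (auto simp: t0_def powr_powr)
  have hs: "\<forall>\<^sub>F n in sequentially. h n < min d t0"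
    unfolding h_def assms by (rule adaptive_bandwidth_small) (use rs \<sigma> d t0 in auto)
  have zero: "(\<lambda>_. 0) \<in> F2"
    using step_bump_in_smoothness_class[OF rs(4), of 0 1 \<omega>2 x0 \<delta>] rs
    by (simp add: step_bump_def assms)
  have "\<forall>\<^sub>F n in sequentially. ennreal ((\<tau> / 2) powr p / 2) \<le> max_risk x0 \<sigma> p \<mu> T F1 \<rho> n"
    using gap risk2 small hs eventually_ge_at_top[of 2]
  proof eventually_elim
    case (elim n)
    have h: "0 < h n" "(\<rho> n)\<^sup>2 * G (h n) = \<sigma>\<^sup>2 * ln (real n) / (2 * real n)"
      using adaptive_bandwidth_level[OF rs(1,3) \<sigma>, of n] elim
      unfolding \<rho>_def adaptive_rate_def h_def assms by auto
    have \<rho>h: "\<rho> n = r1 * h n powr s1" by (simp add: \<rho>_def adaptive_rate_def h_def assms)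
    have \<rho>: "0 < \<rho> n" using h rs by (simp add: \<rho>h)
    have \<psi>: "0 < \<psi> n"
      using minimax_bandwidth_level(1)[OF rs(2,4) \<sigma>, of n] elim rs
      by (simp add: \<psi>_def minimax_rate_def assms)
    have "h n powr s1 \<le> t0 powr s1" using h elim rs by (intro powr_mono2) auto
    then have \<rho>\<sigma>: "\<rho> n \<le> \<sigma>" using rs t0(2) mult_left_mono[of "h n powr s1" "t0 powr s1" r1] by (simp add: \<rho>h)
    define a where "a = \<tau> * \<rho> n"
    have a: "0 < a" "a \<le> \<rho> n" using \<tau> \<rho> by (auto simp: a_def mult_left_le_one_le)
    have a2: "a\<^sup>2 \<le> \<sigma>\<^sup>2" using a \<rho>\<sigma> by (intro power_mono) auto
    have "4 * real n * G (h n) * a\<^sup>2 / \<sigma>\<^sup>2 = 4 * real n * \<tau>\<^sup>2 * ((\<rho> n)\<^sup>2 * G (h n)) / \<sigma>\<^sup>2"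
      by (simp add: a_def power_mult_distrib)
    also have "\<dots> = 2 * \<tau>\<^sup>2 * ln (real n)"
      unfolding h(2) using \<sigma> elim by (simp add: field_simps)
    finally have Q: "exp (4 * real n * G (h n) * a\<^sup>2 / \<sigma>\<^sup>2) = real n powr (2 * \<tau>\<^sup>2)"
      using elim by (simp add: powr_def)
    define R where "R = C * \<psi> n powr p"
    have "ennreal (\<psi> n powr - p) * pointwise_risk x0 \<sigma> p \<mu> T n (\<lambda>_. 0) \<le> max_risk x0 \<sigma> p \<mu> T F2 \<psi> n"
      unfolding max_risk_def by (rule SUP_upper) (use zero in auto)
    then have "ennreal (\<psi> n powr p) * (ennreal (\<psi> n powr - p) * pointwise_risk x0 \<sigma> p \<mu> T n (\<lambda>_. 0))
        \<le> ennreal (\<psi> n powr p) * ennreal C"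
      using elim by (intro mult_left_mono) auto
    then have risk0: "pointwise_risk x0 \<sigma> p \<mu> T n (\<lambda>_. 0) \<le> ennreal R"
      using \<psi> C(1) by (simp add: R_def mult.commute flip: mult.assoc ennreal_mult powr_add)
    have "\<psi> n powr p \<le> (K * real n powr - \<epsilon> * \<rho> n) powr p"
      using elim \<psi> p by (intro powr_mono2) auto
    also have "\<dots> = K powr p * real n powr - (\<epsilon> * p) * \<rho> n powr p"
      using K \<rho> by (simp add: powr_mult powr_powr)
    finally have "4 * real n powr (2 * \<tau>\<^sup>2) * R
        \<le> 4 * real n powr (2 * \<tau>\<^sup>2) * (C * (K powr p * real n powr - (\<epsilon> * p) * \<rho> n powr p))"
      unfolding R_def using C(1) by (intro mult_left_mono) auto
    also have "\<dots> = 4 * C * K powr p * real n powr (2 * \<tau>\<^sup>2 - \<epsilon> * p) * \<rho> n powr p"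
      by (simp add: powr_diff powr_minus divide_inverse)
    also have "\<dots> \<le> (\<tau> / 2) powr p * \<rho> n powr p"
      using elim by (intro mult_right_mono) auto
    also have "\<dots> = (a / 2) powr p"
      using \<tau> \<rho> by (simp add: a_def flip: powr_mult)
    finally have sm: "4 * exp (4 * real n * G (h n) * a\<^sup>2 / \<sigma>\<^sup>2) * R \<le> (a / 2) powr p"
      unfolding Q .
    have risk1: "ennreal ((a / 2) powr p / 2) \<le> pointwise_risk x0 \<sigma> p \<mu> T n (step_bump x0 (h n) a)"
      using d(2) elim h a p C(1)
      by (intro bump_risk_lower[OF prof \<mu> \<sigma> _ _ \<open>estimator_at x0 T\<close> _ _ a2 _ risk0 sm])
        (auto simp: R_def)
    have F1: "step_bump x0 (h n) a \<in> F1"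
      unfolding \<open>F1 = _\<close>
    proof (rule step_bump_in_smoothness_class)
      fix t assume "h n < t"
      then have "h n powr s1 \<le> t powr s1" using h rs by (intro powr_mono2) auto
      then show "a \<le> \<omega>1 t"
        using order_trans[OF a(2)] rs by (simp add: \<rho>h assms)
    qed (use rs a in auto)
    have "ennreal ((\<tau> / 2) powr p / 2) = ennreal (\<rho> n powr - p) * ennreal ((a / 2) powr p / 2)"
      using \<tau> \<rho> by (simp add: a_def powr_mult powr_divide powr_minus field_simps flip: ennreal_mult)
    also have "\<dots> \<le> ennreal (\<rho> n powr - p) * pointwise_risk x0 \<sigma> p \<mu> T n (step_bump x0 (h n) a)"
      by (intro mult_left_mono risk1) simp
    also have "\<dots> \<le> max_risk x0 \<sigma> p \<mu> T F1 \<rho> n"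
      unfolding max_risk_def by (rule SUP_upper) (use F1 in auto)
    finally show ?case .
  qed
  then have "ennreal ((\<tau> / 2) powr p / 2) \<le> liminf (\<lambda>n. max_risk x0 \<sigma> p \<mu> T F1 \<rho> n)"
    by (rule Liminf_bounded)
  moreover have "0 < ennreal ((\<tau> / 2) powr p / 2)" using \<tau> by simp
  ultimately show ?thesis unfolding \<rho>_def by (rule less_le_trans[rotated])
qed

end
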